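(* Let $\mu_n$ ($n\in\mathbb{N}$) and $\mu$ be finite signed Borel measures on $\mathbb{R}$. Then $\mu_n$ converges vaguely to $\mu$ as $n\to\infty$ if and only if both of the following hold: (i) $\mu_n$ converges to $\mu$ either basically or almost basically (the equivalence holds with (i) read as "$\mu_n$ converges basically to $\mu$", and it also holds with (i) read as "$\mu_n$ converges almost basically to $\mu$"); (ii) $(\mu_n)_{n\in\mathbb{N}}$ is locally uniformly bounded in variation, i.e. for all $r\in\mathbb{R}$ we have $\sup_{n\in\mathbb{N}}|\mu_n|([-r,r])<\infty$. Moreover, in (ii) it is sufficient that only one part is locally bounded: if $\mu_n=\mu_n^+-\mu_n^-$ for all $n\in\mathbb{N}$ is any decomposition into finite non-negative measures $\mu_n^+,\mu_n^-$ (not necessarily the Hahn-Jordan decomposition), if (i) holds (in either reading), and if at least one of the sequences $(\mu_n^+)_{n\in\mathbb{N}}$, $(\mu_n^-)_{n\in\mathbb{N}}$ is locally uniformly bounded in variation (i.e. $\sup_n\mu_n^+([-r,r])<\infty$ for all $r$, or $\sup_n\mu_n^-([-r,r])<\infty$ for all $r$), then $\mu_n$ converges vaguely to $\mu$.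
   Context: For a finite signed Borel measure $\mu$ on $\mathbb{R}$, $|\mu|$ denotes its total variation measure and $F^{(\mu)}(x)=\mu((-\infty,x])$ its distribution function. $\mu_n$ converges vaguely to $\mu$ if $\int_{\mathbb{R}} f\,d\mu_n\to\int_{\mathbb{R}} f\,d\mu$ for all continuous $f:\mathbb{R}\to\mathbb{R}$ with compact support. Functions $f_n:\mathbb{R}\to\mathbb{R}$ converge basically to $f:\mathbb{R}\to\mathbb{R}$ if every subsequence $(f_{n_k})_{k}$ contains a further subsequence $(f_{n_{k_l}})_{l}$ and there is an at most countable set $S\subset\mathbb{R}$ (which may depend on the subsequence) such that $f_{n_{k_l}}(x_1)-f_{n_{k_l}}(x_2)\to f(x_1)-f(x_2)$ as $l\to\infty$ for all $x_1,x_2\in\mathbb{R}\setminus S$. Almost basic convergence is defined in the same way, with "at most countable set $S$" replaced by "set $S$ of Lebesgue measure zero". Finite signed measures $\mu_n$ converge basically (resp. almost basically) to $\mu$ if $F^{(\mu_n)}$ converges basically (resp. almost basically) to $F^{(\mu)}$. *)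

theory Defs
  imports "HOL-Analysis.Analysis" "HOL-Probability.Distribution_Functions"
begin

text \<open>
  A finite signed Borel measure on the real line is a real-valued, countably additive set function
  on the Borel sets. Its values on non-Borel sets are irrelevant and never used below.
\<close>

definition finite_signed_borel_measure :: "(real set \<Rightarrow> real) \<Rightarrow> bool" where
  "finite_signed_borel_measure \<mu> \<longleftrightarrow>
     \<mu> {} = 0 \<and>
     (\<forall>A :: nat \<Rightarrow> real set. range A \<subseteq> sets borel \<longrightarrow> disjoint_family A \<longrightarrow>
        (\<lambda>i. \<mu> (A i)) sums \<mu> (\<Union>i. A i))"

definition total_variation :: "(real set \<Rightarrow> real) \<Rightarrow> real set \<Rightarrow> ennreal" where
  "total_variation \<mu> A =
     (SUP B \<in> {B :: nat \<Rightarrow> real set. range B \<subseteq> sets borel \<and> disjoint_family B \<and> (\<Union>i. B i) = A}.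
        \<Sum>i. ennreal \<bar>\<mu> (B i)\<bar>)"

text \<open>
  The Hahn-Jordan parts of a signed measure, given by the upper and lower variation
  \<open>\<mu>\<^sup>+(A) = sup {\<mu>(B) | B \<subseteq> A}\<close> and \<open>\<mu>\<^sup>-(A) = sup {-\<mu>(B) | B \<subseteq> A}\<close>. The truncation of negative
  values by \<open>ennreal\<close> is harmless since \<open>B = {}\<close> is admissible.
\<close>

definition jordan_pos :: "(real set \<Rightarrow> real) \<Rightarrow> real measure" where
  "jordan_pos \<mu> =
     measure_of UNIV (sets borel) (\<lambda>A. SUP B \<in> {B \<in> sets borel. B \<subseteq> A}. ennreal (\<mu> B))"

definition jordan_neg :: "(real set \<Rightarrow> real) \<Rightarrow> real measure" where
  "jordan_neg \<mu> =
     measure_of UNIV (sets borel) (\<lambda>A. SUP B \<in> {B \<in> sets borel. B \<subseteq> A}. ennreal (- \<mu> B))"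

definition signed_integral :: "(real set \<Rightarrow> real) \<Rightarrow> (real \<Rightarrow> real) \<Rightarrow> real" where
  "signed_integral \<mu> f = integral\<^sup>L (jordan_pos \<mu>) f - integral\<^sup>L (jordan_neg \<mu>) f"

definition distribution_function :: "(real set \<Rightarrow> real) \<Rightarrow> real \<Rightarrow> real" where
  "distribution_function \<mu> x = \<mu> {..x}"

definition converges_vaguely :: "(nat \<Rightarrow> real set \<Rightarrow> real) \<Rightarrow> (real set \<Rightarrow> real) \<Rightarrow> bool" where
  "converges_vaguely \<mu> \<nu> \<longleftrightarrow>
     (\<forall>f :: real \<Rightarrow> real. continuous_on UNIV f \<longrightarrow> compact (closure {x. f x \<noteq> 0}) \<longrightarrow>
        (\<lambda>n. signed_integral (\<mu> n) f) \<longlonglongrightarrow> signed_integral \<nu> f)"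

text \<open>
  Strictly monotone index maps \<open>k\<close>, \<open>l\<close> encode the subsequence and the further subsequence; the
  exceptional set may depend on both.
\<close>

definition fun_converges_basically :: "(nat \<Rightarrow> real \<Rightarrow> real) \<Rightarrow> (real \<Rightarrow> real) \<Rightarrow> bool" where
  "fun_converges_basically f g \<longleftrightarrow>
     (\<forall>k :: nat \<Rightarrow> nat. strict_mono k \<longrightarrow>
        (\<exists>(l :: nat \<Rightarrow> nat) S. strict_mono l \<and> countable S \<and>
           (\<forall>x1 \<in> - S. \<forall>x2 \<in> - S.
              (\<lambda>i. f (k (l i)) x1 - f (k (l i)) x2) \<longlonglongrightarrow> g x1 - g x2)))"

definition fun_converges_almost_basically ::
    "(nat \<Rightarrow> real \<Rightarrow> real) \<Rightarrow> (real \<Rightarrow> real) \<Rightarrow> bool" where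
  "fun_converges_almost_basically f g \<longleftrightarrow>
     (\<forall>k :: nat \<Rightarrow> nat. strict_mono k \<longrightarrow>
        (\<exists>(l :: nat \<Rightarrow> nat) S. strict_mono l \<and> S \<in> null_sets lebesgue \<and>
           (\<forall>x1 \<in> - S. \<forall>x2 \<in> - S.
              (\<lambda>i. f (k (l i)) x1 - f (k (l i)) x2) \<longlonglongrightarrow> g x1 - g x2)))"

definition converges_basically :: "(nat \<Rightarrow> real set \<Rightarrow> real) \<Rightarrow> (real set \<Rightarrow> real) \<Rightarrow> bool" where
  "converges_basically \<mu> \<nu> \<longleftrightarrow>
     fun_converges_basically (\<lambda>n. distribution_function (\<mu> n)) (distribution_function \<nu>)"

definition converges_almost_basically ::
    "(nat \<Rightarrow> real set \<Rightarrow> real) \<Rightarrow> (real set \<Rightarrow> real) \<Rightarrow> bool" where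
  "converges_almost_basically \<mu> \<nu> \<longleftrightarrow>
     fun_converges_almost_basically (\<lambda>n. distribution_function (\<mu> n)) (distribution_function \<nu>)"

text \<open>
  The argument is the sequence of variation measures: \<open>|\<mu>\<^sub>n|\<close> for signed measures, and the
  measures themselves when they are non-negative.
\<close>

definition locally_uniformly_bounded :: "(nat \<Rightarrow> real set \<Rightarrow> ennreal) \<Rightarrow> bool" where
  "locally_uniformly_bounded v \<longleftrightarrow> (\<forall>r :: real. (SUP n. v n {- r..r}) < \<infinity>)"

definition is_decomposition ::
    "(real set \<Rightarrow> real) \<Rightarrow> real measure \<Rightarrow> real measure \<Rightarrow> bool" where
  "is_decomposition \<mu> P N \<longleftrightarrow>
     finite_borel_measure P \<and> finite_borel_measure N \<and>
     (\<forall>A \<in> sets borel. \<mu> A = measure P A - measure N A)"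

end

theory Submission
  imports Defs "HOL-Probability.Helly_Selection"
begin

text \<open>
  Almost basic convergence makes the increments of the distribution functions converge between
  points of a dense set, along a subsequence. A continuous function of compact support is uniformly
  close to step functions with jumps in that set, so local boundedness of the variations gives
  vague convergence; since the increments are bounded, a bound for one part of a decomposition
  gives a bound for the other one. Conversely, vague convergence implies local boundedness by
  Banach-Steinhaus. By Helly's theorem a subsequence of the distribution functions of the variation
  measures then converges outside a countable set, and at continuity points of the limit the
  intervals can be replaced by trapezoidal test functions with an arbitrarily small error.
\<close>

subsection \<open>Jordan decomposition\<close>

text \<open>Cancellation is the obstacle. For unit mass at 0 minus unit mass at 1/n the vague limit
  is 0, yet the distribution functions equal 1 at 0. Exceptional points therefore cannot be read off
  the limit measure: they sit where the variations of \<open>\<mu> n\<close> concentrate, which may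
  differ between subsequences. This is why Helly selection is applied to the variations and why
  convergence is claimed only along further subsequences. Increments occur instead of values because
  test functions of compact support do not see mass escaping to infinity, so the distribution
  functions may drift by constants. Banach-Steinhaus needs a complete space, which compactly
  supported functions do not form under the sup norm; the functionals therefore live on bounded
  continuous functions, with a fixed cutoff factor inside the integral. Since signed measures are
  bare set functions here, the Jordan parts must first be shown to be finite measures.\<close>

lemma signed_measure_sums:
  assumes "finite_signed_borel_measure \<mu>" "\<And>i::nat. A i \<in> sets borel" "disjoint_family A"
  shows "(\<lambda>i. \<mu> (A i)) sums \<mu> (\<Union>i. A i)"
proof -
  have "range A \<subseteq> sets borel" using assms(2) by auto
  with assms show ?thesis unfolding finite_signed_borel_measure_def by blast
qed

lemma signed_measure_Un:
  assumes "finite_signed_borel_measure \<mu>" "A \<in> sets borel" "B \<in> sets borel" "A \<inter> B = {}"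
  shows "\<mu> (A \<union> B) = \<mu> A + \<mu> B"
proof -
  let ?C = "binaryset A B"
  have 0: "\<mu> {} = 0" using assms(1) by (simp add: finite_signed_borel_measure_def)
  have "range ?C \<subseteq> sets borel" using assms by (simp add: range_binaryset_eq)
  moreover have "disjoint_family ?C"
    using assms(4) by (auto simp: disjoint_family_on_def binaryset_def)
  ultimately have "(\<lambda>i. \<mu> (?C i)) sums \<mu> (\<Union>i. ?C i)"
    using assms(1) unfolding finite_signed_borel_measure_def by blast
  then have "(\<lambda>i. \<mu> (?C i)) sums \<mu> (A \<union> B)" by (simp add: UN_binaryset_eq)
  moreover have "(\<lambda>i. \<mu> (?C i)) sums (\<mu> A + \<mu> B)"
    by (rule binaryset_sums[of \<mu>, OF 0])
  ultimately show ?thesis by (rule sums_unique2)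
qed

lemma signed_measure_Diff:
  assumes "finite_signed_borel_measure \<mu>" "A \<in> sets borel" "B \<in> sets borel" "B \<subseteq> A"
  shows "\<mu> (A - B) = \<mu> A - \<mu> B"
proof -
  have "\<mu> (B \<union> (A - B)) = \<mu> B + \<mu> (A - B)"
    by (rule signed_measure_Un) (use assms in auto)
  moreover have "B \<union> (A - B) = A" using assms by auto
  ultimately show ?thesis by simp
qed

lemma signed_measure_uminus:
  "finite_signed_borel_measure \<mu> \<Longrightarrow> finite_signed_borel_measure (\<lambda>A. - \<mu> A)"
  by (auto simp: finite_signed_borel_measure_def intro!: sums_minus)

lemma jordan_neg_eq: "jordan_neg \<mu> = jordan_pos (\<lambda>A. - \<mu> A)"
  by (simp add: jordan_neg_def jordan_pos_def)

text \<open>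
  If the values below some set were unbounded, one could split off pieces of absolute measure at
  least 1 forever, always continuing in a part that is still unbounded; the values of the disjoint
  pieces would not be summable.
\<close>

lemma signed_measure_bounded:
  assumes "finite_signed_borel_measure \<mu>"
  shows "\<exists>C. \<forall>A \<in> sets borel. \<bar>\<mu> A\<bar> \<le> C"
proof (rule ccontr)
  assume neg: "\<not> ?thesis"
  define unbdd where "unbdd E \<longleftrightarrow> E \<in> sets borel \<and> (\<forall>C. \<exists>A\<in>sets borel. A \<subseteq> E \<and> \<bar>\<mu> A\<bar> > C)" for E
  have U: "unbdd UNIV" using neg by (force simp: unbdd_def not_le)
  have step: "\<exists>E'. unbdd E' \<and> E' \<subseteq> E \<and> \<bar>\<mu> (E - E')\<bar> \<ge> 1" if E: "unbdd E" for E
  proof -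
    have Eb: "E \<in> sets borel" using E by (simp add: unbdd_def)
    \<comment> \<open>The margin \<open>\<bar>\<mu> E\<bar>\<close> gives both \<open>A\<close> and
      \<open>E - A\<close> absolute measure at least 1, so whichever of the two stays unbounded, the
      other can be split off.\<close>
    obtain A where A: "A \<in> sets borel" "A \<subseteq> E" "\<bar>\<mu> A\<bar> > 1 + \<bar>\<mu> E\<bar>"
      using E unfolding unbdd_def by blast
    have d: "\<mu> (E - A) = \<mu> E - \<mu> A" by (rule signed_measure_Diff[OF assms Eb A(1,2)])
    have or: "unbdd A \<or> unbdd (E - A)"
    proof (rule ccontr)
      assume "\<not> ?thesis"
      then have "\<not> unbdd A" "\<not> unbdd (E - A)" by auto
      moreover have "E - A \<in> sets borel" using Eb A(1) by auto
      ultimately obtain C1 C2 where C: "\<And>B. B \<in> sets borel \<Longrightarrow> B \<subseteq> A \<Longrightarrow> \<bar>\<mu> B\<bar> \<le> C1"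
        "\<And>B. B \<in> sets borel \<Longrightarrow> B \<subseteq> E - A \<Longrightarrow> \<bar>\<mu> B\<bar> \<le> C2"
        using A(1) unfolding unbdd_def by (metis not_less)
      have "\<bar>\<mu> B\<bar> \<le> C1 + C2" if B: "B \<in> sets borel" "B \<subseteq> E" for B
      proof -
        have "\<mu> ((B \<inter> A) \<union> (B - A)) = \<mu> (B \<inter> A) + \<mu> (B - A)"
          by (rule signed_measure_Un[OF assms]) (use A B in auto)
        moreover have "(B \<inter> A) \<union> (B - A) = B" by auto
        moreover have "\<bar>\<mu> (B \<inter> A)\<bar> \<le> C1" "\<bar>\<mu> (B - A)\<bar> \<le> C2"
          by (rule C; use A B in auto)+
        ultimately show ?thesis by simp
      qed
      then show False using E unfolding unbdd_def by (meson not_le)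
    qed
    have "E - (E - A) = A" using A(2) by blast
    have big: "\<bar>\<mu> (E - A)\<bar> \<ge> 1" using A(3) d by linarith
    from or show ?thesis
    proof
      assume "unbdd A"
      with A(2) big show ?thesis by blast
    next
      assume "unbdd (E - A)"
      moreover have "\<bar>\<mu> (E - (E - A))\<bar> \<ge> 1" using A(3) \<open>E - (E - A) = A\<close> by simp
      ultimately show ?thesis by blast
    qed
  qed
  have "\<exists>E. \<forall>n. unbdd (E n) \<and> (E (Suc n) \<subseteq> E n \<and> \<bar>\<mu> (E n - E (Suc n))\<bar> \<ge> 1)"
    by (rule dependent_nat_choice) (use U step in blast)+
  then obtain E where E: "\<And>n. unbdd (E n)" "\<And>n. E (Suc n) \<subseteq> E n" "\<And>n. \<bar>\<mu> (E n - E (Suc n))\<bar> \<ge> 1"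
    by blast
  have anti: "E n \<subseteq> E m" if "m \<le> n" for m n
    by (rule lift_Suc_antimono_le) (use E(2) that in auto)
  have "disjoint_family (\<lambda>n. E n - E (Suc n))"
    unfolding disjoint_family_on_def
  proof (intro ballI impI)
    fix m n :: nat assume "m \<noteq> n"
    then show "(E m - E (Suc m)) \<inter> (E n - E (Suc n)) = {}"
      using anti[of "Suc m" n] anti[of "Suc n" m] by (cases "m < n") auto
  qed
  moreover have "E n \<in> sets borel" for n using E(1)[of n] by (simp add: unbdd_def)
  ultimately have "(\<lambda>n. \<mu> (E n - E (Suc n))) sums \<mu> (\<Union>n. E n - E (Suc n))"
    by (intro signed_measure_sums[OF assms]) auto
  then have "(\<lambda>n. \<mu> (E n - E (Suc n))) \<longlonglongrightarrow> 0"
    using summable_LIMSEQ_zero sums_summable by blast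
  then have "\<forall>\<^sub>F n in sequentially. \<bar>\<mu> (E n - E (Suc n))\<bar> < 1"
    by (auto simp: tendsto_iff dist_real_def dest: spec[of _ 1])
  then obtain n where "\<bar>\<mu> (E n - E (Suc n))\<bar> < 1" by (auto simp: eventually_sequentially)
  with E(3)[of n] show False by simp
qed

lemma sets_jordan_pos [simp]: "sets (jordan_pos \<mu>) = sets borel"
proof -
  have "sigma_sets UNIV (sets borel) = (sets borel :: real set set)"
    using sets.sigma_sets_eq[where M = "borel :: real measure"] by simp
  then show ?thesis by (simp add: jordan_pos_def)
qed

text \<open>\<open>measure_of\<close> returns the zero measure unless its set function is a measure,
  so the formula becomes usable only once the upper variation is known to be countably additive.
  Superadditivity on finite disjoint unions gives one inequality; cutting a competitor
  \<open>B\<close> along the pieces \<open>A i\<close> gives the other.\<close>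

lemma emeasure_jordan_pos:
  assumes \<mu>: "finite_signed_borel_measure \<mu>" and A: "A \<in> sets borel"
  shows "emeasure (jordan_pos \<mu>) A = (SUP B \<in> {B \<in> sets borel. B \<subseteq> A}. ennreal (\<mu> B))"
proof -
  define p where "p A = (SUP B \<in> {B \<in> sets borel. B \<subseteq> A}. ennreal (\<mu> B))" for A
  have p: "jordan_pos \<mu> = measure_of UNIV (sets borel) p"
    by (simp add: jordan_pos_def p_def[abs_def])
  have mu0: "\<mu> {} = 0" using \<mu> by (simp add: finite_signed_borel_measure_def)
  have "{B \<in> sets borel. B \<subseteq> {}} = {{} :: real set}" by auto
  then have "p {} = 0" by (simp add: p_def mu0)
  then have pos: "positive (sets (jordan_pos \<mu>)) p" by (simp add: positive_def)
  have upper: "ennreal (\<mu> B) \<le> p A" if "B \<in> sets borel" "B \<subseteq> A" for A B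
    unfolding p_def by (rule SUP_upper) (use that in auto)
  have mono: "p A \<le> p B" if "A \<subseteq> B" for A B
    unfolding p_def by (rule SUP_subset_mono) (use that in auto)
  have add: "p A + p B \<le> p (A \<union> B)" if "A \<in> sets borel" "B \<in> sets borel" "A \<inter> B = {}" for A B
  proof -
    have "ennreal (\<mu> X) + ennreal (\<mu> Y) \<le> p (A \<union> B)"
      if X: "X \<in> sets borel" "X \<subseteq> A" and Y: "Y \<in> sets borel" "Y \<subseteq> B" for X Y
    proof -
      have un: "\<mu> (X \<union> Y) = \<mu> X + \<mu> Y"
        by (rule signed_measure_Un[OF \<mu>]) (use X Y \<open>A \<inter> B = {}\<close> in auto)
      \<comment> \<open>\<open>ennreal\<close> is additive only on nonnegative reals. A piece of
        nonpositive measure counts as 0 and is dropped, leaving the other piece as competitor for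
        the union.\<close>
      consider "\<mu> X \<ge> 0" "\<mu> Y \<ge> 0" | "\<mu> X \<le> 0" | "\<mu> Y \<le> 0" by linarith
      then show ?thesis
      proof cases
        case 1
        then have "ennreal (\<mu> X) + ennreal (\<mu> Y) = ennreal (\<mu> (X \<union> Y))" by (simp add: un)
        also have "\<dots> \<le> p (A \<union> B)" by (rule upper) (use X Y in auto)
        finally show ?thesis .
      next
        case 2
        then show ?thesis using upper[of Y "A \<union> B"] Y by (auto simp: ennreal_neg)
      next
        case 3
        then show ?thesis using upper[of X "A \<union> B"] X by (auto simp: ennreal_neg)
      qed
    qed
    moreover have "{X \<in> sets borel. X \<subseteq> C} \<noteq> {}" for C :: "real set"
      using sets.empty_sets by blast
    ultimately show ?thesis
      unfolding p_def[of A] p_def[of B]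
      by (simp add: ennreal_SUP_add_left[symmetric] ennreal_SUP_add_right SUP_le_iff)
  qed
  have ca: "countably_additive (sets (jordan_pos \<mu>)) p"
    unfolding countably_additive_def
  proof (intro allI impI)
    fix A :: "nat \<Rightarrow> real set"
    assume "range A \<subseteq> sets (jordan_pos \<mu>)" and dis: "disjoint_family A"
    then have Ab: "A i \<in> sets borel" for i by auto
    have "(\<Sum>i<m. p (A i)) \<le> p (\<Union>i<m. A i)" for m
    proof (induction m)
      case (Suc m)
      have "(\<Sum>i<Suc m. p (A i)) \<le> p (\<Union>i<m. A i) + p (A m)"
        using Suc by (simp add: add_right_mono)
      also have "\<dots> \<le> p ((\<Union>i<m. A i) \<union> A m)"
        using Ab dis by (intro add) (auto simp: disjoint_family_on_def, metis IntI emptyE less_irrefl)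
      also have "(\<Union>i<m. A i) \<union> A m = (\<Union>i<Suc m. A i)" by (auto simp: less_Suc_eq)
      finally show ?case .
    qed simp
    then have "(\<Sum>i<m. p (A i)) \<le> p (\<Union>i. A i)" for m
      by (rule order_trans) (auto intro!: mono)
    then have le: "(\<Sum>i. p (A i)) \<le> p (\<Union>i. A i)"
      by (intro suminf_le_const) auto
    have "ennreal (\<mu> B) \<le> (\<Sum>i. p (A i))" if B: "B \<in> sets borel" "B \<subseteq> (\<Union>i. A i)" for B
    proof -
      have "(\<lambda>i. \<mu> (B \<inter> A i)) sums \<mu> (\<Union>i. B \<inter> A i)"
        using Ab B by (intro signed_measure_sums[OF \<mu>] disjoint_family_subset[OF dis]) auto
      moreover have "(\<Union>i. B \<inter> A i) = B" using B by auto
      ultimately have lim: "(\<lambda>m. \<Sum>i<m. \<mu> (B \<inter> A i)) \<longlonglongrightarrow> \<mu> B" by (simp add: sums_def)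
      have "ennreal (\<Sum>i<m. \<mu> (B \<inter> A i)) \<le> (\<Sum>i. p (A i))" for m
      proof -
        \<comment> \<open>Terms of mixed sign do not commute with \<open>ennreal\<close>; passing to
          positive parts only increases the sum and makes it split termwise.\<close>
        have "ennreal (\<Sum>i<m. \<mu> (B \<inter> A i)) \<le> ennreal (\<Sum>i<m. max 0 (\<mu> (B \<inter> A i)))"
          by (intro ennreal_leI sum_mono) auto
        also have "\<dots> = (\<Sum>i<m. ennreal (\<mu> (B \<inter> A i)))"
          by (subst sum_ennreal[symmetric]) (simp_all add: ennreal_max_0)
        also have "\<dots> \<le> (\<Sum>i<m. p (A i))"
          by (intro sum_mono upper) (use Ab B in auto)
        also have "\<dots> \<le> (\<Sum>i. p (A i))" by (intro sum_le_suminf) auto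
        finally show ?thesis .
      qed
      then show ?thesis
        using tendsto_ennrealI[OF lim] by (intro LIMSEQ_le_const2) auto
    qed
    then have "p (\<Union>i. A i) \<le> (\<Sum>i. p (A i))"
      unfolding p_def[of "\<Union>i. A i"] by (auto intro!: SUP_least)
    with le show "(\<Sum>i. p (A i)) = p (\<Union>i. A i)" by (rule antisym)
  qed
  have "emeasure (jordan_pos \<mu>) A = p A"
    by (rule emeasure_measure_of[OF p]) (use pos ca A in simp_all)
  then show ?thesis by (simp add: p_def)
qed

lemma finite_borel_measure_jordan_pos:
  assumes "finite_signed_borel_measure \<mu>"
  shows "finite_borel_measure (jordan_pos \<mu>)"
proof -
  obtain C where "\<And>A. A \<in> sets borel \<Longrightarrow> \<bar>\<mu> A\<bar> \<le> C" using signed_measure_bounded[OF assms] by blast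
  then have "emeasure (jordan_pos \<mu>) UNIV \<le> ennreal C"
    by (subst emeasure_jordan_pos[OF assms]) (auto intro!: SUP_least ennreal_leI simp: abs_le_iff)
  moreover have "space (jordan_pos \<mu>) = UNIV"
    using sets_eq_imp_space_eq[OF sets_jordan_pos] by simp
  ultimately have "finite_measure (jordan_pos \<mu>)"
    by (intro finite_measureI) (auto simp: top_unique)
  then show ?thesis by (simp add: finite_borel_measure_def finite_borel_measure_axioms_def)
qed

lemma le_measure_jordan_pos:
  assumes "finite_signed_borel_measure \<mu>" "B \<in> sets borel" "A \<in> sets borel" "B \<subseteq> A"
  shows "\<mu> B \<le> measure (jordan_pos \<mu>) A"
proof -
  interpret finite_borel_measure "jordan_pos \<mu>" by (rule finite_borel_measure_jordan_pos[OF assms(1)])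
  have "ennreal (\<mu> B) \<le> emeasure (jordan_pos \<mu>) A"
    using assms by (subst emeasure_jordan_pos) (auto intro!: SUP_upper)
  then show ?thesis by (simp add: emeasure_eq_measure)
qed

lemma measure_jordan_pos_le:
  assumes "finite_signed_borel_measure \<mu>" "A \<in> sets borel"
    "\<And>B. B \<in> sets borel \<Longrightarrow> B \<subseteq> A \<Longrightarrow> \<mu> B \<le> c"
  shows "measure (jordan_pos \<mu>) A \<le> c"
proof -
  interpret finite_borel_measure "jordan_pos \<mu>" by (rule finite_borel_measure_jordan_pos[OF assms(1)])
  have "0 \<le> c" using assms(3)[of "{}"] assms(1) by (simp add: finite_signed_borel_measure_def)
  moreover have "emeasure (jordan_pos \<mu>) A \<le> ennreal c"
    using assms by (subst emeasure_jordan_pos) (auto intro!: SUP_least ennreal_leI)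
  ultimately show ?thesis by (simp add: emeasure_eq_measure)
qed

text \<open>For \<open>B \<subseteq> A\<close> we have
  \<open>\<mu> B = \<mu> A - \<mu> (A - B)\<close>, and \<open>- \<mu> (A - B)\<close> competes in
  the supremum for the negative part. Taking the supremum over \<open>B\<close> gives one
  inequality; the same argument for \<open>- \<mu>\<close> gives the other.\<close>

theorem jordan_is_decomposition:
  assumes \<mu>: "finite_signed_borel_measure \<mu>"
  shows "is_decomposition \<mu> (jordan_pos \<mu>) (jordan_neg \<mu>)"
  unfolding is_decomposition_def
proof (intro conjI ballI)
  note \<mu>' = signed_measure_uminus[OF \<mu>]
  show "finite_borel_measure (jordan_pos \<mu>)" by (rule finite_borel_measure_jordan_pos[OF \<mu>])
  show "finite_borel_measure (jordan_neg \<mu>)"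
    unfolding jordan_neg_eq by (rule finite_borel_measure_jordan_pos[OF \<mu>'])
  fix A :: "real set" assume A: "A \<in> sets borel"
  have "measure (jordan_pos \<mu>) A \<le> \<mu> A + measure (jordan_neg \<mu>) A"
  proof (rule measure_jordan_pos_le[OF \<mu> A])
    fix B :: "real set" assume B: "B \<in> sets borel" "B \<subseteq> A"
    show "\<mu> B \<le> \<mu> A + measure (jordan_neg \<mu>) A"
      using le_measure_jordan_pos[OF \<mu>' _ A, of "A - B"] signed_measure_Diff[OF \<mu> A B] A B
      by (simp add: jordan_neg_eq)
  qed
  moreover have "measure (jordan_neg \<mu>) A \<le> measure (jordan_pos \<mu>) A - \<mu> A"
    unfolding jordan_neg_eq
  proof (rule measure_jordan_pos_le[OF \<mu>' A])
    fix B :: "real set" assume B: "B \<in> sets borel" "B \<subseteq> A"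
    show "- \<mu> B \<le> measure (jordan_pos \<mu>) A - \<mu> A"
      using le_measure_jordan_pos[OF \<mu> _ A, of "A - B"] signed_measure_Diff[OF \<mu> A B] A B
      by simp
  qed
  ultimately show "\<mu> A = measure (jordan_pos \<mu>) A - measure (jordan_neg \<mu>) A" by simp
qed

lemma total_variation_le:
  assumes "is_decomposition \<mu> P N" and A: "A \<in> sets borel"
  shows "total_variation \<mu> A \<le> emeasure P A + emeasure N A"
  unfolding total_variation_def
proof (rule SUP_least, safe)
  interpret P: finite_borel_measure P using assms by (simp add: is_decomposition_def)
  interpret N: finite_borel_measure N using assms by (simp add: is_decomposition_def)
  fix B :: "nat \<Rightarrow> real set"
  assume B: "range B \<subseteq> sets borel" "disjoint_family B" and A': "A = (\<Union>i. B i)"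
  have "(\<Sum>i. ennreal \<bar>\<mu> (B i)\<bar>) \<le> (\<Sum>i. emeasure P (B i) + emeasure N (B i))"
  proof (rule suminf_le)
    fix i
    have "\<mu> (B i) = measure P (B i) - measure N (B i)"
      using assms B by (auto simp: is_decomposition_def)
    then have "\<bar>\<mu> (B i)\<bar> \<le> measure P (B i) + measure N (B i)"
      using measure_nonneg[of P "B i"] measure_nonneg[of N "B i"] by linarith
    then show "ennreal \<bar>\<mu> (B i)\<bar> \<le> emeasure P (B i) + emeasure N (B i)"
      by (simp add: P.emeasure_eq_measure N.emeasure_eq_measure ennreal_plus[symmetric] ennreal_leI
          del: ennreal_plus)
  qed auto
  also have "\<dots> = (\<Sum>i. emeasure P (B i)) + (\<Sum>i. emeasure N (B i))"
    by (intro suminf_add[symmetric]) auto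
  also have "\<dots> = emeasure P A + emeasure N A"
    unfolding A' using B
    by (intro arg_cong2[where f="(+)"] suminf_emeasure) (auto simp: P.M_is_borel N.M_is_borel)
  finally show "(\<Sum>i. ennreal \<bar>\<mu> (B i)\<bar>) \<le> emeasure P (\<Union> (range B)) + emeasure N (\<Union> (range B))"
    by (simp add: A')
qed

text \<open>The partition tested is \<open>B\<close>, \<open>A - B\<close>, followed by empty sets,
  whose terms vanish by \<open>\<mu> {} = 0\<close>.\<close>

lemma total_variation_ge:
  assumes \<mu>: "\<mu> {} = 0" and "A \<in> sets borel" "B \<in> sets borel" "B \<subseteq> A"
  shows "ennreal \<bar>\<mu> B\<bar> \<le> total_variation \<mu> A"
proof -
  let ?C = "binaryset B (A - B)"
  have "(\<lambda>i. ennreal \<bar>\<mu> (?C i)\<bar>) sums (ennreal \<bar>\<mu> B\<bar> + ennreal \<bar>\<mu> (A - B)\<bar>)"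
    by (rule binaryset_sums[where f="\<lambda>X. ennreal \<bar>\<mu> X\<bar>"]) (simp add: \<mu>)
  then have "ennreal \<bar>\<mu> B\<bar> \<le> (\<Sum>i. ennreal \<bar>\<mu> (?C i)\<bar>)"
    by (simp add: sums_iff)
  also have "\<dots> \<le> total_variation \<mu> A"
    unfolding total_variation_def
    using assms
    by (intro SUP_upper)
       (auto simp: range_binaryset_eq UN_binaryset_eq disjoint_family_on_def binaryset_def)
  finally show ?thesis .
qed

lemma jordan_pos_le_total_variation:
  assumes "finite_signed_borel_measure \<mu>" "A \<in> sets borel"
  shows "emeasure (jordan_pos \<mu>) A \<le> total_variation \<mu> A"
  using assms
  by (subst emeasure_jordan_pos)
     (auto simp: finite_signed_borel_measure_def
        intro!: SUP_least order_trans[OF ennreal_leI[OF abs_ge_self] total_variation_ge])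

subsection \<open>Sequences, functionals and Helly selection\<close>

lemma LIMSEQ_if_subsubsequence:
  fixes X :: "nat \<Rightarrow> 'a::metric_space"
  assumes "\<And>k::nat \<Rightarrow> nat. strict_mono k \<Longrightarrow> \<exists>l::nat \<Rightarrow> nat. strict_mono l \<and> (\<lambda>i. X (k (l i))) \<longlonglongrightarrow> L"
  shows "X \<longlonglongrightarrow> L"
proof (rule ccontr)
  assume "\<not> ?thesis"
  then obtain e where e: "e > 0" "\<not> (\<forall>\<^sub>F n in sequentially. dist (X n) L < e)"
    by (auto simp: tendsto_iff)
  obtain k :: "nat \<Rightarrow> nat" where k: "strict_mono k" "\<And>n. \<not> dist (X (k n)) L < e"
    using not_eventually_sequentiallyD[OF e(2)] by blast
  obtain l :: "nat \<Rightarrow> nat" where "(\<lambda>i. X (k (l i))) \<longlonglongrightarrow> L" using assms[OF k(1)] by blast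
  then have "\<forall>\<^sub>F i in sequentially. dist (X (k (l i))) L < e" using e(1) by (rule tendstoD)
  then show False using k(2) by (auto simp: eventually_sequentially)
qed

text \<open>\<open>S\<close> and \<open>L'\<close> may change with \<open>e\<close>, so that step
  sums or trapezoids can be refined as the tolerance shrinks. Three errors of \<open>e / 4\<close>
  stay below \<open>e\<close>.\<close>

lemma LIMSEQ_by_approximation:
  fixes X :: "nat \<Rightarrow> real"
  assumes "\<And>e. e > 0 \<Longrightarrow> \<exists>S L'. S \<longlonglongrightarrow> L' \<and> (\<forall>\<^sub>F n in sequentially. \<bar>X n - S n\<bar> \<le> e) \<and> \<bar>L - L'\<bar> \<le> e"
  shows "X \<longlonglongrightarrow> L"
proof (rule tendstoI)
  fix e :: real assume "e > 0"
  then obtain S L' where S: "S \<longlonglongrightarrow> L'" "\<forall>\<^sub>F n in sequentially. \<bar>X n - S n\<bar> \<le> e / 4" "\<bar>L - L'\<bar> \<le> e / 4"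
    using assms[of "e / 4"] by auto
  have "\<forall>\<^sub>F n in sequentially. dist (S n) L' < e / 4" using S(1) \<open>e > 0\<close> by (intro tendstoD) auto
  with S(2) show "\<forall>\<^sub>F n in sequentially. dist (X n) L < e"
  proof eventually_elim
    case (elim n)
    then show ?case using S(3) \<open>e > 0\<close> unfolding dist_real_def by linarith
  qed
qed

text \<open>By Baire some level set \<open>E k\<close> contains a ball \<open>cball y r\<close>. A
  vector \<open>z\<close> of norm \<open>r\<close> is the difference of the points
  \<open>y + z\<close> and \<open>y\<close> of that ball, so \<open>norm (T n z)\<close> is at most
  \<open>2 * k\<close> for all \<open>n\<close>; rescaling gives the constant
  \<open>2 * k / r\<close>.\<close>

lemma Banach_Steinhaus:
  fixes T :: "nat \<Rightarrow> 'a::{real_normed_vector,complete_space} \<Rightarrow> 'b::real_normed_vector"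
  assumes T: "\<And>n. bounded_linear (T n)" and bdd: "\<And>x. bounded (range (\<lambda>n. T n x))"
  obtains C where "\<And>n x. norm (T n x) \<le> C * norm x"
proof -
  define E where "E k = (\<Inter>n. {x. norm (T n x) \<le> real k})" for k
  have closed: "closed (E k)" for k
    unfolding E_def
    by (intro closed_INT ballI closed_Collect_le continuous_intros bounded_linear.continuous_on[OF T])
  have "\<exists>k. x \<in> E k" for x
  proof -
    obtain c where c: "\<And>n. norm (T n x) \<le> c" using bdd[of x] by (auto simp: bounded_iff)
    obtain k where "c \<le> real k" using real_arch_simple by blast
    then have "x \<in> E k" using c by (auto simp: E_def intro: order_trans)
    then show ?thesis ..
  qed
  then have "(\<Union>k. E k) = UNIV" by auto
  then have "\<exists>k. interior (E k) \<noteq> {}"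
    using Baire_category_alt[of "euclidean :: 'a topology" "range E"] closed
    by (force simp: completely_metrizable_space_euclidean)
  then obtain k y r where r: "r > 0" and ball: "cball y r \<subseteq> E k"
    by (metis ex_in_conv mem_interior_cball)
  have "norm (T n x) \<le> 2 * real k / r * norm x" for n x
  proof (cases "x = 0")
    case True
    then show ?thesis by (simp add: linear_0 bounded_linear.linear[OF T])
  next
    case False
    define z where "z = (r / norm x) *\<^sub>R x"
    have "y \<in> E k" "y + z \<in> E k"
      using r False by (auto intro!: subsetD[OF ball] simp: z_def dist_norm)
    then have "norm (T n y) \<le> k" "norm (T n (y + z)) \<le> k" by (auto simp: E_def)
    moreover have "T n z = T n (y + z) - T n y"
      using bounded_linear.linear[OF T] by (simp add: linear_add)
    ultimately have "norm (T n z) \<le> 2 * real k" using norm_triangle_ineq4[of "T n (y + z)" "T n y"] by simp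
    moreover have "norm (T n z) = r / norm x * norm (T n x)"
      using r bounded_linear.linear[OF T] by (simp add: z_def linear_cmul)
    ultimately show ?thesis using r False by (simp add: field_simps)
  qed
  then show thesis by (rule that)
qed

text \<open>
  The monotone transformation \<open>arctan\<close> makes a pointwise bounded sequence uniformly bounded, and
  pointwise boundedness keeps the limit away from \<open>\<plusminus>\<pi>/2\<close>, so that \<open>tan\<close> transforms back.
\<close>

lemma local_Helly_selection:
  fixes f :: "nat \<Rightarrow> real \<Rightarrow> real"
  assumes rcont: "\<And>n x. continuous (at_right x) (f n)"
    and mono: "\<And>n. mono (f n)"
    and bdd: "\<And>n x. \<bar>f n x\<bar> \<le> C x"
  shows "\<exists>s G S. strict_mono (s :: nat \<Rightarrow> nat) \<and> countable S \<and>
    (\<forall>x. x \<notin> S \<longrightarrow> isCont G x \<and> (\<lambda>n. f (s n) x) \<longlonglongrightarrow> G x)"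
proof -
  have "\<exists>s. strict_mono (s::nat \<Rightarrow> nat) \<and> (\<exists>F. (\<forall>x. continuous (at_right x) F) \<and> mono F \<and> (\<forall>x. \<bar>F x\<bar> \<le> pi / 2) \<and>
      (\<forall>x. continuous (at x) F \<longrightarrow> (\<lambda>n. arctan (f (s n) x)) \<longlonglongrightarrow> F x))"
  proof (rule Helly_selection[where f="\<lambda>n x. arctan (f n x)"])
    show "continuous (at_right x) (\<lambda>x. arctan (f n x))" for n x
      using rcont[of x n] by (intro continuous_intros)
    show "mono (\<lambda>x. arctan (f n x))" for n
      using mono[of n] by (simp add: mono_def arctan_le_iff)
    show "\<bar>arctan (f n x)\<bar> \<le> pi / 2" for n x
      using arctan_ubound[of "f n x"] arctan_lbound[of "f n x"] by linarith
  qed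
  then obtain s F where s: "strict_mono (s::nat \<Rightarrow> nat)" and F: "mono F"
    and lim: "\<And>x. isCont F x \<Longrightarrow> (\<lambda>n. arctan (f (s n) x)) \<longlonglongrightarrow> F x" by blast
  have cos: "cos (F x) \<noteq> 0" if "isCont F x" for x
  proof -
    have "arctan (f n x) \<le> arctan (C x)" "arctan (- C x) \<le> arctan (f n x)" for n
      using bdd[of n x] by (auto simp: abs_le_iff arctan_le_iff simp del: arctan_minus)
    then have "F x \<le> arctan (C x)" "arctan (- C x) \<le> F x"
      using lim[OF that] by (auto intro: LIMSEQ_le_const2 LIMSEQ_le_const)
    then have "- (pi / 2) < F x" "F x < pi / 2"
      using arctan_ubound[of "C x"] arctan_lbound[of "- C x"] by linarith+
    then show ?thesis using cos_gt_zero_pi[of "F x"] by simp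
  qed
  show ?thesis
  proof (intro exI conjI allI impI)
    show "strict_mono s" by (rule s)
    show "countable {x. \<not> isCont F x}" by (rule mono_ctble_discont[OF F])
    fix x assume "x \<notin> {x. \<not> isCont F x}"
    then have x: "isCont F x" by simp
    show "isCont (\<lambda>x. tan (F x)) x" using x cos[OF x] by (intro continuous_intros)
    have "(\<lambda>n. tan (arctan (f (s n) x))) \<longlonglongrightarrow> tan (F x)"
      by (rule isCont_tendsto_compose[OF isCont_tan[OF cos[OF x]] lim[OF x]])
    then show "(\<lambda>n. f (s n) x) \<longlonglongrightarrow> tan (F x)" by (simp add: tan_arctan)
  qed
qed

subsection \<open>Approximation of test functions\<close>

lemma integrable_continuous_compact_support:
  fixes f :: "real \<Rightarrow> real"
  assumes "finite_borel_measure M" "continuous_on UNIV f" "\<And>x. \<bar>x\<bar> \<ge> R \<Longrightarrow> f x = 0"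
  shows "integrable M f"
proof -
  interpret finite_borel_measure M by fact
  have "compact (f ` {-R..R})"
    by (intro compact_continuous_image continuous_on_subset[OF assms(2)]) auto
  then obtain B where B: "\<And>y. y \<in> f ` {-R..R} \<Longrightarrow> \<bar>y\<bar> \<le> B"
    by (meson bounded_real compact_imp_bounded)
  have "\<bar>f x\<bar> \<le> max B 0" for x
  proof (cases "\<bar>x\<bar> \<ge> R")
    case False
    then have "x \<in> {-R..R}" by auto
    then show ?thesis using B[of "f x"] by fastforce
  qed (simp add: assms(3))
  moreover have "f \<in> borel_measurable M"
    using borel_measurable_continuous_onI[OF assms(2)] measurable_cong_sets[OF M_is_borel refl] by blast
  ultimately show ?thesis by (intro integrable_const_bound[where B="max B 0"]) auto
qed

lemma compact_support_iff:
  fixes f :: "real \<Rightarrow> real"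
  shows "compact (closure {x. f x \<noteq> 0}) \<longleftrightarrow> (\<exists>R\<ge>0. \<forall>x. \<bar>x\<bar> \<ge> R \<longrightarrow> f x = 0)"
proof
  assume "compact (closure {x. f x \<noteq> 0})"
  then have "bounded {x. f x \<noteq> 0}"
    by (rule bounded_subset[OF compact_imp_bounded closure_subset])
  then obtain B where B: "\<And>x. f x \<noteq> 0 \<Longrightarrow> \<bar>x\<bar> \<le> B" by (auto simp: bounded_real)
  have "f x = 0" if "\<bar>x\<bar> \<ge> \<bar>B\<bar> + 1" for x
  proof (rule ccontr)
    assume "f x \<noteq> 0"
    then show False using B[of x] that by linarith
  qed
  then show "\<exists>R\<ge>0. \<forall>x. \<bar>x\<bar> \<ge> R \<longrightarrow> f x = 0" by (intro exI[of _ "\<bar>B\<bar> + 1"]) auto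
next
  assume "\<exists>R\<ge>0. \<forall>x. \<bar>x\<bar> \<ge> R \<longrightarrow> f x = 0"
  then obtain R where R: "\<And>x. \<bar>x\<bar> \<ge> R \<Longrightarrow> f x = 0" by blast
  have "{x. f x \<noteq> 0} \<subseteq> {-R..R}"
  proof safe
    fix x assume "f x \<noteq> 0"
    then have "\<not> \<bar>x\<bar> \<ge> R" using R by blast
    then show "x \<in> {-R..R}" by auto
  qed
  then have "bounded {x. f x \<noteq> 0}" by (rule bounded_subset[rotated]) simp
  then show "compact (closure {x. f x \<noteq> 0})" by (simp add: compact_closure)
qed

lemma indicator_consecutive_intervals:
  fixes t :: "nat \<Rightarrow> real"
  assumes "incseq t"
  shows "(\<Sum>i<m. indicator {t i<..t (Suc i)} x) = (indicator {t 0<..t m} x :: real)"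
proof (induction m)
  case (Suc m)
  have "t 0 \<le> t m" "t m \<le> t (Suc m)" using assms by (auto simp: incseq_def)
  then show ?case using Suc by (auto simp: indicator_def)
qed simp

text \<open>Splitting \<open>f\<close> minus its step function along the cells bounds it pointwise
  by \<open>e\<close> times an indicator, so the error is charged only against the mass of
  \<open>{t 0<..t m}\<close>. This is what makes local bounds sufficient when total masses are
  unbounded in \<open>n\<close>.\<close>

lemma integral_step_error:
  fixes f :: "real \<Rightarrow> real" and t :: "nat \<Rightarrow> real"
  assumes M: "finite_borel_measure M" and f: "integrable M f" and t: "incseq t"
    and osc: "\<And>i x. i < m \<Longrightarrow> t i < x \<Longrightarrow> x \<le> t (Suc i) \<Longrightarrow> \<bar>f x - f (t (Suc i))\<bar> \<le> e"
    and zero: "\<And>x. x \<notin> {t 0<..t m} \<Longrightarrow> f x = 0"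
  shows "\<bar>integral\<^sup>L M f - (\<Sum>i<m. f (t (Suc i)) * measure M {t i<..t (Suc i)})\<bar> \<le> e * measure M {t 0<..t m}"
proof -
  interpret finite_borel_measure M by fact
  have space_eq: "space M = UNIV" using sets_eq_imp_space_eq[OF M_is_borel] by simp
  define s where "s x = (\<Sum>i<m. f (t (Suc i)) * indicator {t i<..t (Suc i)} x)" for x
  have ind: "integrable M (indicator A :: real \<Rightarrow> real)" if "A \<in> sets borel" for A
    using that by (simp add: M_is_borel emeasure_eq_measure)
  have s: "integrable M s" unfolding s_def
    by (intro Bochner_Integration.integrable_sum integrable_mult_right ind) auto
  have "\<bar>f x - s x\<bar> \<le> e * indicator {t 0<..t m} x" for x
  proof -
    have "f x = f x * indicator {t 0<..t m} x" using zero[of x] by (auto simp: indicator_def)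
    also have "\<dots> = (\<Sum>i<m. f x * indicator {t i<..t (Suc i)} x)"
      by (simp add: indicator_consecutive_intervals[OF t, symmetric] sum_distrib_left)
    finally have "f x - s x = (\<Sum>i<m. (f x - f (t (Suc i))) * indicator {t i<..t (Suc i)} x)"
      by (simp add: s_def sum_subtractf left_diff_distrib)
    also have "\<bar>\<dots>\<bar> \<le> (\<Sum>i<m. e * indicator {t i<..t (Suc i)} x)"
      by (rule sum_abs[THEN order_trans], rule sum_mono) (auto simp: indicator_def osc)
    also have "\<dots> = e * indicator {t 0<..t m} x"
      by (simp add: indicator_consecutive_intervals[OF t, symmetric] sum_distrib_left)
    finally show ?thesis .
  qed
  then have "\<bar>\<integral>x. f x - s x \<partial>M\<bar> \<le> (\<integral>x. e * indicator {t 0<..t m} x \<partial>M)"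
    using f s by (intro order_trans[OF integral_abs_bound] integral_mono integrable_abs
        Bochner_Integration.integrable_diff integrable_mult_right ind) auto
  moreover have "(\<integral>x. s x \<partial>M) = (\<Sum>i<m. f (t (Suc i)) * measure M {t i<..t (Suc i)})"
    unfolding s_def
    by (subst Bochner_Integration.integral_sum) (auto intro!: integrable_mult_right ind simp: space_eq)
  ultimately show ?thesis using f s by (simp add: space_eq)
qed

lemma fine_mesh:
  fixes f :: "real \<Rightarrow> real"
  assumes f: "continuous_on UNIV f" and D: "\<And>a b. a < b \<Longrightarrow> \<exists>x\<in>D. a < x \<and> x < b"
    and R: "R \<ge> 0" and e: "e > 0"
  obtains t :: "nat \<Rightarrow> real" and m where "strict_mono t" "range t \<subseteq> D"
    "\<And>i x. i < m \<Longrightarrow> t i < x \<Longrightarrow> x \<le> t (Suc i) \<Longrightarrow> \<bar>f x - f (t (Suc i))\<bar> \<le> e"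
    "- R - 1 < t 0" "t 0 < - R" "R < t m" "t m < R + 1"
proof -
  have "uniformly_continuous_on {- R - 2..R + 2} f"
    by (intro compact_uniformly_continuous continuous_on_subset[OF f]) auto
  then obtain d where d: "d > 0"
    "\<And>x y. x \<in> {- R - 2..R + 2} \<Longrightarrow> y \<in> {- R - 2..R + 2} \<Longrightarrow> dist y x < d \<Longrightarrow> dist (f y) (f x) < e"
    unfolding uniformly_continuous_on_def using e by meson
  \<comment> \<open>One node is picked in each cell of length \<open>h\<close>, so neighbouring
    nodes may be almost two cells apart, whence \<open>d/2\<close>. The bound \<open>1/2\<close>
    keeps the first and last nodes within the prescribed unit margins.\<close>
  define h where "h = min (1/2) (d/2)"
  have h: "h > 0" "h \<le> 1/2" "2 * h \<le> d" using d(1) by (auto simp: h_def)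
  have "\<exists>x\<in>D. - R - 1 + real i * h < x \<and> x < - R - 1 + real (Suc i) * h" for i
    using h(1) by (intro D) (simp add: algebra_simps)
  then obtain t where t: "\<And>i. t i \<in> D" "\<And>i. - R - 1 + real i * h < t i"
    "\<And>i. t i < - R - 1 + real (Suc i) * h" by metis
  \<comment> \<open>The smallest number of cells covering length \<open>2 * R + 1\<close>: starting
    at \<open>- R - 1\<close>, the node \<open>t m\<close> lies beyond \<open>R\<close> but
    overshoots by less than \<open>2 * h\<close>.\<close>
  define m where "m = nat \<lceil>(2 * R + 1) / h\<rceil>"
  have "(2 * R + 1) / h \<le> m" "m < (2 * R + 1) / h + 1"
    using R h(1) by (auto simp: m_def; linarith)+
  then have m: "2 * R + 1 \<le> real m * h" "real m * h < 2 * R + 1 + h"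
    using h(1) by (auto simp: field_simps)
  have gap: "t i < t (Suc i)" "t (Suc i) < t i + 2 * h" for i
    using t(2)[of i] t(3)[of i] t(2)[of "Suc i"] t(3)[of "Suc i"] by (auto simp: algebra_simps)
  then have mono: "strict_mono t" by (simp add: strict_mono_Suc_iff)
  have tm: "t m < R + 1" using t(3)[of m] m(2) h(2) by (simp add: algebra_simps)
  have t0: "- R - 1 < t 0" using t(2)[of 0] by simp
  show thesis
  proof
    show "strict_mono t" "range t \<subseteq> D" using mono t(1) by auto
    show "- R - 1 < t 0" "t 0 < - R" using t(2,3)[of 0] h by auto
    show "R < t m" "t m < R + 1" using t(2)[of m] m(1) tm by auto
    fix i x assume i: "i < m" and x: "t i < x" "x \<le> t (Suc i)"
    have "t 0 \<le> t i" "t (Suc i) \<le> t m"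
      using i mono by (auto simp: strict_mono_less_eq)
    then have "dist (f x) (f (t (Suc i))) < e"
      using t0 tm x gap[of i] h by (intro d(2)) (auto simp: dist_real_def)
    then show "\<bar>f x - f (t (Suc i))\<bar> \<le> e" by (simp add: dist_real_def)
  qed
qed

text \<open>A step sum has finitely many terms, with nodes in \<open>D\<close> that stay fixed while
  \<open>n\<close> varies, so it converges by \<open>lim\<close>; the local mass bound makes its
  distance from the integral uniform in \<open>n\<close>. Only differences of masses enter
  \<open>lim\<close>, so the two parts may fail to converge separately.\<close>

proposition vague_limit_from_dense_intervals:
  fixes f :: "real \<Rightarrow> real"
  assumes P: "\<And>n. finite_borel_measure (P n)" and N: "\<And>n. finite_borel_measure (N n)"
    and P': "finite_borel_measure P'" and N': "finite_borel_measure N'"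
    and D: "\<And>a b. a < b \<Longrightarrow> \<exists>x\<in>D. a < x \<and> x < b"
    and lim: "\<And>a b. a \<in> D \<Longrightarrow> b \<in> D \<Longrightarrow> a < b \<Longrightarrow>
      (\<lambda>n. measure (P n) {a<..b} - measure (N n) {a<..b}) \<longlonglongrightarrow> measure P' {a<..b} - measure N' {a<..b}"
    and bdd: "\<And>r. \<exists>C. \<forall>n. measure (P n) {-r..r} \<le> C \<and> measure (N n) {-r..r} \<le> C"
    and f: "continuous_on UNIV f" "compact (closure {x. f x \<noteq> 0})"
  shows "(\<lambda>n. integral\<^sup>L (P n) f - integral\<^sup>L (N n) f) \<longlonglongrightarrow> integral\<^sup>L P' f - integral\<^sup>L N' f"
proof (rule LIMSEQ_by_approximation)
  fix e :: real assume e: "e > 0"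
  obtain R where R: "R \<ge> 0" "\<And>x. \<bar>x\<bar> \<ge> R \<Longrightarrow> f x = 0"
    using f(2) unfolding compact_support_iff by blast
  let ?I = "{-(R+1)..R+1}"
  obtain C0 where C0: "\<And>n. measure (P n) ?I \<le> C0" "\<And>n. measure (N n) ?I \<le> C0"
    using bdd[of "R+1"] by blast
  \<comment> \<open>The limit measures are included because the same error estimate is applied to
    them. The summand 1 keeps \<open>C\<close> positive for the division in
    \<open>e / (2 * C)\<close>, where the 2 accounts for the two parts of a difference.\<close>
  define C where "C = 1 + max 0 (max C0 (max (measure P' ?I) (measure N' ?I)))"
  have C: "C > 0" "\<And>n. measure (P n) ?I \<le> C" "\<And>n. measure (N n) ?I \<le> C"
    "measure P' ?I \<le> C" "measure N' ?I \<le> C"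
  proof -
    have "C0 \<le> C" "measure P' ?I \<le> C" "measure N' ?I \<le> C" "C > 0" by (auto simp: C_def)
    then show "C > 0" "\<And>n. measure (P n) ?I \<le> C" "\<And>n. measure (N n) ?I \<le> C"
      "measure P' ?I \<le> C" "measure N' ?I \<le> C"
      using C0 order_trans by blast+
  qed
  have "e / (2 * C) > 0" using e C by simp
  then obtain t m where t: "strict_mono t" "range t \<subseteq> D"
    and osc: "\<And>i x. i < m \<Longrightarrow> t i < x \<Longrightarrow> x \<le> t (Suc i) \<Longrightarrow> \<bar>f x - f (t (Suc i))\<bar> \<le> e / (2 * C)"
    and ends: "- R - 1 < t 0" "t 0 < - R" "R < t m" "t m < R + 1"
    using fine_mesh[OF f(1) D R(1)] by metis
  define s where "s M = (\<Sum>i<m. f (t (Suc i)) * measure M {t i<..t (Suc i)})" for M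
  have err: "\<bar>integral\<^sup>L M f - s M\<bar> \<le> e / 2" if M: "finite_borel_measure M" "measure M ?I \<le> C" for M
  proof -
    interpret M: finite_borel_measure M by (rule M(1))
    have "\<bar>integral\<^sup>L M f - s M\<bar> \<le> e / (2 * C) * measure M {t 0<..t m}"
      unfolding s_def
    proof (rule integral_step_error)
      show "integrable M f" by (rule integrable_continuous_compact_support[OF M(1) f(1) R(2)])
      show "f x = 0" if "x \<notin> {t 0<..t m}" for x
        using that ends by (intro R(2)) auto
    qed (use M(1) t(1) osc in \<open>auto simp: strict_mono_mono\<close>)
    also have "\<dots> \<le> e / (2 * C) * C"
    proof (rule mult_left_mono)
      have "measure M {t 0<..t m} \<le> measure M ?I"
        by (rule M.finite_measure_mono) (use ends in auto)
      then show "measure M {t 0<..t m} \<le> C" using M(2) by simp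
      show "0 \<le> e / (2 * C)" using e C by simp
    qed
    finally show ?thesis using C(1) by simp
  qed
  have sdiff: "s M - s M' = (\<Sum>i<m. f (t (Suc i)) * (measure M {t i<..t (Suc i)} - measure M' {t i<..t (Suc i)}))"
    for M M' by (simp add: s_def sum_subtractf right_diff_distrib)
  have "(\<lambda>n. s (P n) - s (N n)) \<longlonglongrightarrow> s P' - s N'"
    unfolding sdiff
    by (intro tendsto_intros lim) (use t in \<open>auto simp: strict_mono_less\<close>)
  moreover have "\<bar>integral\<^sup>L (P n) f - integral\<^sup>L (N n) f - (s (P n) - s (N n))\<bar> \<le> e" for n
    using err[OF P C(2), of n] err[OF N C(3), of n] by linarith
  moreover have "\<bar>integral\<^sup>L P' f - integral\<^sup>L N' f - (s P' - s N')\<bar> \<le> e"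
    using err[OF P' C(4)] err[OF N' C(5)] by linarith
  ultimately show "\<exists>S L'. S \<longlonglongrightarrow> L' \<and>
      (\<forall>\<^sub>F n in sequentially. \<bar>integral\<^sup>L (P n) f - integral\<^sup>L (N n) f - S n\<bar> \<le> e) \<and>
      \<bar>integral\<^sup>L P' f - integral\<^sup>L N' f - L'\<bar> \<le> e"
    by (intro exI conjI) auto
qed

text \<open>The function depends only on the four points, so one test function serves all members of
  the sequence and the limit. It can differ from the indicator only on the two ramps, and there by
  at most 1.\<close>

lemma trapezoid_function:
  fixes a b c d :: real
  assumes "a < c" "c \<le> d" "d < b"
  obtains \<phi> :: "real \<Rightarrow> real" where "continuous_on UNIV \<phi>" "compact (closure {x. \<phi> x \<noteq> 0})"
    "\<And>M. finite_borel_measure M \<Longrightarrow>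
      \<bar>integral\<^sup>L M \<phi> - measure M {c<..d}\<bar> \<le> measure M {a<..c} + measure M {d<..b}"
proof -
  define \<phi> where "\<phi> x = max 0 (min 1 (min ((x - a) / (c - a)) ((b - x) / (b - d))))" for x
  have cont: "continuous_on UNIV \<phi>"
    unfolding \<phi>_def using assms by (intro continuous_intros) auto
  have range: "0 \<le> \<phi> x" "\<phi> x \<le> 1" for x by (auto simp: \<phi>_def)
  have zero: "\<phi> x = 0" if "x \<le> a \<or> b \<le> x" for x
    using that
  proof
    assume "x \<le> a"
    then have "(x - a) / (c - a) \<le> 0" using assms by (simp add: divide_nonpos_pos)
    then show ?thesis by (simp add: \<phi>_def)
  next
    assume "b \<le> x"
    then have "(b - x) / (b - d) \<le> 0" using assms by (simp add: divide_nonpos_pos)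
    then show ?thesis by (simp add: \<phi>_def)
  qed
  have one: "\<phi> x = 1" if "c < x" "x \<le> d" for x
    using that assms by (auto simp: \<phi>_def)
  have zero': "\<phi> x = 0" if "\<bar>x\<bar> \<ge> max \<bar>a\<bar> \<bar>b\<bar>" for x
    using zero[of x] that by (auto simp: abs_if split: if_splits)
  show thesis
  proof
    show "continuous_on UNIV \<phi>" by (rule cont)
    show "compact (closure {x. \<phi> x \<noteq> 0})"
      unfolding compact_support_iff using zero' by (intro exI[of _ "max \<bar>a\<bar> \<bar>b\<bar>"]) auto
    fix M :: "real measure" assume M: "finite_borel_measure M"
    interpret finite_borel_measure M by fact
    have space_eq: "space M = UNIV" using sets_eq_imp_space_eq[OF M_is_borel] by simp
    have ind: "integrable M (indicator A :: real \<Rightarrow> real)" if "A \<in> sets borel" for A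
      using that by (simp add: M_is_borel emeasure_eq_measure)
    have int: "integrable M \<phi>"
      by (rule integrable_continuous_compact_support[OF M cont zero'])
    have "\<bar>\<phi> x - indicator {c<..d} x\<bar> \<le> indicator {a<..c} x + indicator {d<..b} x" for x
      using range[of x] zero[of x] one[of x] assms by (auto simp: indicator_def)
    then have "\<bar>\<integral>x. \<phi> x - indicator {c<..d} x \<partial>M\<bar> \<le> (\<integral>x. indicator {a<..c} x + indicator {d<..b} x \<partial>M)"
      using int by (intro order_trans[OF integral_abs_bound] integral_mono integrable_abs
        Bochner_Integration.integrable_diff Bochner_Integration.integrable_add ind) auto
    then show "\<bar>integral\<^sup>L M \<phi> - measure M {c<..d}\<bar> \<le> measure M {a<..c} + measure M {d<..b}"
      using int ind by (simp add: space_eq)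
  qed
qed

subsection \<open>Signed integrals and local boundedness\<close>

text \<open>Two decompositions give the same differences on half-open intervals. The proposition on
  vague limits, applied to constant sequences, turns this into equality of the integrals.\<close>

lemma signed_integral_decomposition:
  fixes f :: "real \<Rightarrow> real"
  assumes "finite_signed_borel_measure \<mu>" "is_decomposition \<mu> P N"
    and f: "continuous_on UNIV f" "compact (closure {x. f x \<noteq> 0})"
  shows "signed_integral \<mu> f = integral\<^sup>L P f - integral\<^sup>L N f"
proof -
  note J = jordan_is_decomposition[OF assms(1)]
  have "(\<lambda>n::nat. integral\<^sup>L (jordan_pos \<mu>) f - integral\<^sup>L (jordan_neg \<mu>) f)
      \<longlonglongrightarrow> integral\<^sup>L P f - integral\<^sup>L N f"
  proof (rule vague_limit_from_dense_intervals[where D=UNIV])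
    show "\<exists>x\<in>UNIV. a < x \<and> x < b" if "a < b" for a b :: real using dense[OF that] by auto
    show "\<exists>C. \<forall>n::nat. measure (jordan_pos \<mu>) {-r..r} \<le> C \<and> measure (jordan_neg \<mu>) {-r..r} \<le> C" for r
      by (intro exI[of _ "max (measure (jordan_pos \<mu>) {-r..r}) (measure (jordan_neg \<mu>) {-r..r})"]) auto
    show "(\<lambda>n::nat. measure (jordan_pos \<mu>) {a<..b} - measure (jordan_neg \<mu>) {a<..b})
      \<longlonglongrightarrow> measure P {a<..b} - measure N {a<..b}" for a b
    proof -
      have "measure (jordan_pos \<mu>) {a<..b} - measure (jordan_neg \<mu>) {a<..b} = measure P {a<..b} - measure N {a<..b}"
        using J assms(2) by (simp add: is_decomposition_def)
      then show ?thesis by simp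
    qed
  qed (use J assms(2) f in \<open>auto simp: is_decomposition_def\<close>)
  then show ?thesis unfolding signed_integral_def by (simp add: LIMSEQ_const_iff)
qed

lemma signed_integral_uminus: "signed_integral (\<lambda>A. - \<mu> A) f = - signed_integral \<mu> f"
  by (simp add: signed_integral_def jordan_neg_eq)

lemma distribution_function_diff:
  assumes "finite_signed_borel_measure \<mu>" "a \<le> b"
  shows "distribution_function \<mu> b - distribution_function \<mu> a = \<mu> {a<..b}"
proof -
  have "{..b} - {..a} = {a<..b}" by auto
  then show ?thesis
    using signed_measure_Diff[OF assms(1), of "{..b}" "{..a}"] assms(2)
    by (simp add: distribution_function_def)
qed

lemma locally_uniformly_bounded_iff:
  assumes "\<And>n. finite_borel_measure (M n)"
  shows "locally_uniformly_bounded (\<lambda>n. emeasure (M n)) \<longleftrightarrow> (\<forall>r. \<exists>C. \<forall>n. measure (M n) {-r..r} \<le> C)"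
  unfolding locally_uniformly_bounded_def
proof (intro iffI allI)
  have em: "emeasure (M n) A = ennreal (measure (M n) A)" for n A
  proof -
    interpret finite_borel_measure "M n" by (rule assms)
    show ?thesis by (rule emeasure_eq_measure)
  qed
  fix r :: real
  {
    assume "\<forall>r. (SUP n. emeasure (M n) {-r..r}) < \<infinity>"
    then have fin: "(SUP n. emeasure (M n) {-r..r}) < \<infinity>" by blast
    have "measure (M n) {-r..r} \<le> enn2real (SUP n. emeasure (M n) {-r..r})" for n
      unfolding measure_def using fin by (intro enn2real_mono SUP_upper) auto
    then show "\<exists>C. \<forall>n. measure (M n) {-r..r} \<le> C" by blast
  next
    assume "\<forall>r. \<exists>C. \<forall>n. measure (M n) {-r..r} \<le> C"
    then obtain C where "\<And>n. measure (M n) {-r..r} \<le> C" by blast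
    then have "(SUP n. emeasure (M n) {-r..r}) \<le> ennreal C"
      by (intro SUP_least) (simp add: em ennreal_leI)
    then show "(SUP n. emeasure (M n) {-r..r}) < \<infinity>"
      by (rule le_less_trans) simp
  }
qed

text \<open>The total variation lies between each Jordan part and their sum. The negative part is
  handled as the positive part of \<open>- \<mu> n\<close>, which has the same total
  variation.\<close>

lemma locally_uniformly_bounded_total_variation_iff:
  assumes "\<And>n. finite_signed_borel_measure (\<mu> n)"
  shows "locally_uniformly_bounded (\<lambda>n. total_variation (\<mu> n)) \<longleftrightarrow>
    locally_uniformly_bounded (\<lambda>n. emeasure (jordan_pos (\<mu> n))) \<and>
    locally_uniformly_bounded (\<lambda>n. emeasure (jordan_neg (\<mu> n)))"
proof (intro iffI conjI)
  assume TV: "locally_uniformly_bounded (\<lambda>n. total_variation (\<mu> n))"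
  have mono: "locally_uniformly_bounded (\<lambda>n. emeasure (M n))"
    if "\<And>n r. emeasure (M n) {-r..r} \<le> total_variation (\<mu> n) {-r..r}" for M :: "nat \<Rightarrow> real measure"
    unfolding locally_uniformly_bounded_def
  proof
    fix r :: real
    have "(SUP n. emeasure (M n) {-r..r}) \<le> (SUP n. total_variation (\<mu> n) {-r..r})"
      by (rule SUP_mono) (use that in blast)
    also have "\<dots> < \<infinity>" using TV by (simp add: locally_uniformly_bounded_def)
    finally show "(SUP n. emeasure (M n) {-r..r}) < \<infinity>" .
  qed
  have "total_variation (\<lambda>A. - \<mu> n A) = total_variation (\<mu> n)" for n
    by (simp add: total_variation_def fun_eq_iff)
  then show "locally_uniformly_bounded (\<lambda>n. emeasure (jordan_neg (\<mu> n)))"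
    using jordan_pos_le_total_variation[OF signed_measure_uminus[OF assms]]
    by (intro mono) (simp add: jordan_neg_eq)
  show "locally_uniformly_bounded (\<lambda>n. emeasure (jordan_pos (\<mu> n)))"
    using jordan_pos_le_total_variation[OF assms] by (intro mono) simp
next
  assume J: "locally_uniformly_bounded (\<lambda>n. emeasure (jordan_pos (\<mu> n))) \<and>
    locally_uniformly_bounded (\<lambda>n. emeasure (jordan_neg (\<mu> n)))"
  show "locally_uniformly_bounded (\<lambda>n. total_variation (\<mu> n))"
    unfolding locally_uniformly_bounded_def
  proof
    fix r :: real
    have "(SUP n. total_variation (\<mu> n) {-r..r}) \<le>
        (SUP n. emeasure (jordan_pos (\<mu> n)) {-r..r}) + (SUP n. emeasure (jordan_neg (\<mu> n)) {-r..r})"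
      by (intro SUP_least order_trans[OF total_variation_le[OF jordan_is_decomposition[OF assms]]]
          add_mono SUP_upper) auto
    also have "\<dots> < \<infinity>"
      using J by (auto simp: locally_uniformly_bounded_def ennreal_add_less_top)
    finally show "(SUP n. total_variation (\<mu> n) {-r..r}) < \<infinity>" .
  qed
qed

text \<open>The cutoff \<open>\<psi>\<close> carries the support condition, so \<open>g\<close> may
  range over a Banach space. The constant \<open>measure M UNIV\<close> may grow along a sequence of
  measures; a uniform constant comes only from Banach-Steinhaus.\<close>

lemma bounded_linear_integral_cutoff:
  assumes M: "finite_borel_measure M" and \<psi>: "continuous_on UNIV \<psi>" "\<And>x. \<bar>x\<bar> \<ge> R \<Longrightarrow> \<psi> x = 0"
    "\<And>x. \<bar>\<psi> x\<bar> \<le> (1::real)"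
  shows "bounded_linear (\<lambda>g :: real \<Rightarrow>\<^sub>C real. \<integral>x. g x * \<psi> x \<partial>M)"
proof (rule bounded_linear_intro[where K="measure M UNIV"])
  interpret finite_borel_measure M by fact
  have space_eq: "space M = UNIV" using sets_eq_imp_space_eq[OF M_is_borel] by simp
  have int: "integrable M (\<lambda>x. g x * \<psi> x)" for g :: "real \<Rightarrow>\<^sub>C real"
    by (rule integrable_continuous_compact_support[OF M]) (auto intro!: continuous_intros \<psi>)
  show "(\<integral>x. (g + h) x * \<psi> x \<partial>M) = (\<integral>x. g x * \<psi> x \<partial>M) + (\<integral>x. h x * \<psi> x \<partial>M)" for g h :: "real \<Rightarrow>\<^sub>C real"
    using int by (simp add: plus_bcontfun.rep_eq distrib_right)
  show "(\<integral>x. (c *\<^sub>R g) x * \<psi> x \<partial>M) = c *\<^sub>R (\<integral>x. g x * \<psi> x \<partial>M)" for c and g :: "real \<Rightarrow>\<^sub>C real"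
    by (simp add: scaleR_bcontfun.rep_eq mult.assoc)
  show "norm (\<integral>x. g x * \<psi> x \<partial>M) \<le> norm g * measure M UNIV" for g :: "real \<Rightarrow>\<^sub>C real"
  proof -
    have "\<bar>g x * \<psi> x\<bar> \<le> norm g" for x
      using mult_mono[OF norm_bounded[of g x] \<psi>(3)[of x]] by (simp add: abs_mult)
    then have "norm (\<integral>x. g x * \<psi> x \<partial>M) \<le> (\<integral>x. norm g \<partial>M)"
      using int[of g] by (intro order_trans[OF integral_norm_bound] integral_mono) auto
    then show ?thesis by (simp add: space_eq mult.commute)
  qed
qed

text \<open>
  By Banach-Steinhaus the functionals given by \<open>\<mu> n\<close> on test functions cut off outside
  \<open>{- \<bar>r\<bar> - 1..\<bar>r\<bar> + 1}\<close> have uniformly bounded norms. A set \<open>B \<subseteq> {-r..r}\<close> is exhausted by a compact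
  \<open>K\<close>, whose indicator is a limit of such test functions of norm at most 1.
\<close>

lemma jordan_pos_locally_bounded_if_weakly_bounded:
  fixes \<mu> :: "nat \<Rightarrow> real set \<Rightarrow> real"
  assumes \<mu>: "\<And>n. finite_signed_borel_measure (\<mu> n)"
    and bdd: "\<And>f :: real \<Rightarrow> real. continuous_on UNIV f \<Longrightarrow> compact (closure {x. f x \<noteq> 0}) \<Longrightarrow>
      bounded (range (\<lambda>n. signed_integral (\<mu> n) f))"
  shows "\<exists>C. \<forall>n. measure (jordan_pos (\<mu> n)) {-r..r} \<le> C"
proof -
  \<comment> \<open>Since \<open>\<psi>\<close> is 1 on \<open>{-r..r}\<close>, the cutoff does not
    affect sets inside it; \<open>\<bar>r\<bar>\<close> also covers negative \<open>r\<close>, where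
    the interval is empty.\<close>
  define \<psi> where "\<psi> x = max 0 (min 1 (\<bar>r\<bar> + 1 - \<bar>x\<bar>))" for x :: real
  have \<psi>: "continuous_on UNIV \<psi>" "\<And>x. \<bar>x\<bar> \<ge> \<bar>r\<bar> + 1 \<Longrightarrow> \<psi> x = 0" "\<And>x. \<bar>\<psi> x\<bar> \<le> 1"
    "\<And>x. x \<in> {-r..r} \<Longrightarrow> \<psi> x = 1"
    unfolding \<psi>_def by (auto intro!: continuous_intros)
  note J = jordan_is_decomposition[OF \<mu>]
  define T where "T n g = signed_integral (\<mu> n) (\<lambda>x. apply_bcontfun g x * \<psi> x)" for n and g :: "real \<Rightarrow>\<^sub>C real"
  obtain C0 where C0: "\<And>n g. norm (T n g) \<le> C0 * norm g"
  proof (rule Banach_Steinhaus[of T])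
    show "bounded_linear (T n)" for n
      unfolding T_def signed_integral_def using J[of n] \<psi>
      by (intro bounded_linear_sub bounded_linear_integral_cutoff[where R="\<bar>r\<bar> + 1"])
         (auto simp: is_decomposition_def)
    show "bounded (range (\<lambda>n. T n g))" for g
      unfolding T_def
    proof (rule bdd)
      show "continuous_on UNIV (\<lambda>x. g x * \<psi> x)" by (intro continuous_intros \<psi>) auto
      show "compact (closure {x. g x * \<psi> x \<noteq> 0})"
        unfolding compact_support_iff using \<psi>(2) by (intro exI[of _ "\<bar>r\<bar> + 1"]) auto
    qed
  qed (rule that, blast)
  define C where "C = max C0 0"
  have C: "T n g \<le> C" if "norm g \<le> 1" for n g
  proof -
    have "T n g \<le> C0 * norm g" using C0[of n g] by simp
    also have "\<dots> \<le> C * 1" using that by (intro mult_mono) (auto simp: C_def)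
    finally show ?thesis by simp
  qed
  have compact_le: "\<mu> n K \<le> C" if K: "compact K" "K \<subseteq> {-r..r}" for n K
  \<comment> \<open>\<open>infdist x {}\<close> is 0 by convention, so for empty \<open>K\<close>
    the functions \<open>\<phi> k\<close> below would be constantly 1.\<close>
  proof (cases "K = {}")
    case True
    then show ?thesis using \<mu>[of n] by (simp add: finite_signed_borel_measure_def C_def)
  next
    case False
    have Kb: "K \<in> sets borel" using K(1) by (simp add: compact_imp_closed)
    \<comment> \<open>For positive \<open>k\<close> this is 1 on \<open>K\<close> and 0 at distance
      at least \<open>1 / k\<close>. As \<open>K\<close> is closed, every outside point has positive
      distance and is eventually sent to 0.\<close>
    define \<phi> where "\<phi> k x = max 0 (1 - real k * infdist x K)" for k x
    have \<phi>: "\<phi> k \<in> bcontfun" "0 \<le> \<phi> k x" "\<phi> k x \<le> 1" for k x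
    proof -
      show range: "0 \<le> \<phi> k x" "\<phi> k x \<le> 1" for x by (auto simp: \<phi>_def infdist_nonneg)
      have "continuous_on UNIV (\<phi> k)" unfolding \<phi>_def by (intro continuous_intros)
      moreover have "bounded (range (\<phi> k))"
        unfolding bounded_iff using range by (intro exI[of _ 1]) auto
      ultimately show "\<phi> k \<in> bcontfun" by (simp add: bcontfun_def)
    qed
    have lim_\<phi>: "(\<lambda>k. \<phi> k x * \<psi> x) \<longlonglongrightarrow> indicator K x" for x
    proof (cases "x \<in> K")
      case True
      then show ?thesis using K \<psi>(4)[of x] by (auto simp: \<phi>_def)
    next
      case False
      then have pos: "infdist x K > 0"
        using K(1) \<open>K \<noteq> {}\<close> by (simp add: infdist_pos_not_in_closed compact_imp_closed)
      obtain k0 where k0: "1 / infdist x K \<le> real k0" using real_arch_simple by blast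
      have "\<phi> k x = 0" if "k \<ge> k0" for k
      proof -
        have "1 / infdist x K \<le> real k" by (rule order_trans[OF k0]) (use that in simp)
        then show ?thesis using pos by (simp add: \<phi>_def field_simps)
      qed
      then have "\<forall>\<^sub>F k in sequentially. \<phi> k x * \<psi> x = indicator K x"
        using False by (auto simp: eventually_sequentially)
      then show ?thesis by (rule tendsto_eventually)
    qed
    have lim: "(\<lambda>k. \<integral>x. \<phi> k x * \<psi> x \<partial>M) \<longlonglongrightarrow> measure M K" if M: "finite_borel_measure M" for M
    proof -
      interpret finite_borel_measure M by fact
      have space_eq: "space M = UNIV" using sets_eq_imp_space_eq[OF M_is_borel] by simp
      have "(\<lambda>k. \<integral>x. \<phi> k x * \<psi> x \<partial>M) \<longlonglongrightarrow> (\<integral>x. indicator K x \<partial>M)"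
      proof (rule integral_dominated_convergence[where w="\<lambda>_. 1"])
        show "(\<lambda>x. \<phi> k x * \<psi> x) \<in> borel_measurable M" for k
        proof -
          have "continuous_on UNIV (\<lambda>x. \<phi> k x * \<psi> x)"
            using \<phi>(1)[of k] \<psi>(1) by (auto simp: bcontfun_def intro!: continuous_intros)
          then show ?thesis
            using borel_measurable_continuous_onI measurable_cong_sets[OF M_is_borel refl] by blast
        qed
        show "AE x in M. norm (\<phi> k x * \<psi> x) \<le> 1" for k
          using \<phi>(2,3) \<psi>(3) by (intro AE_I2) (auto simp: abs_mult intro!: mult_le_one)
        show "(indicator K :: real \<Rightarrow> real) \<in> borel_measurable M"
          using Kb by (intro borel_measurable_indicator) (simp add: M_is_borel)
      qed (use lim_\<phi> in auto)
      then show ?thesis by (simp add: space_eq)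
    qed
    have "T n (Bcontfun (\<phi> k)) \<le> C" for k
      using \<phi> by (intro C norm_bound) (auto simp: Bcontfun_inverse)
    moreover have "(\<lambda>k. T n (Bcontfun (\<phi> k))) \<longlonglongrightarrow> measure (jordan_pos (\<mu> n)) K - measure (jordan_neg (\<mu> n)) K"
      unfolding T_def signed_integral_def Bcontfun_inverse[OF \<phi>(1)]
      using J[of n] by (intro tendsto_diff lim) (auto simp: is_decomposition_def)
    moreover have "measure (jordan_pos (\<mu> n)) K - measure (jordan_neg (\<mu> n)) K = \<mu> n K"
      using J[of n] Kb by (simp add: is_decomposition_def)
    ultimately show ?thesis by (auto intro: LIMSEQ_le_const2)
  qed
  have "measure (jordan_pos (\<mu> n)) {-r..r} \<le> C" for n
  proof (rule measure_jordan_pos_le[OF \<mu>])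
    fix B :: "real set" assume B: "B \<in> sets borel" "B \<subseteq> {-r..r}"
    interpret P: finite_borel_measure "jordan_pos (\<mu> n)" by (rule finite_borel_measure_jordan_pos[OF \<mu>])
    show "\<mu> n B \<le> C"
    proof (rule field_le_epsilon)
      fix e :: real assume e: "e > 0"
      \<comment> \<open>Inner regularity is used for the positive Jordan part because it dominates
        \<open>\<mu> n (B - K)\<close> from above, the direction in which the remainder must be
        small.\<close>
      have "\<exists>K. K \<subseteq> B \<and> compact K \<and> measure (jordan_pos (\<mu> n)) B - e < measure (jordan_pos (\<mu> n)) K"
      \<comment> \<open>A negative level would be truncated by \<open>ennreal\<close>; the empty
        compact set settles that case.\<close>
      proof (cases "measure (jordan_pos (\<mu> n)) B - e < 0")
        case True
        then show ?thesis by (intro exI[of _ "{}"]) auto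
      next
        case False
        have "ennreal (measure (jordan_pos (\<mu> n)) B - e) < emeasure (jordan_pos (\<mu> n)) B"
          using e False by (auto simp: P.emeasure_eq_measure intro!: ennreal_lessI)
        also have "\<dots> = (SUP K \<in> {K. K \<subseteq> B \<and> compact K}. emeasure (jordan_pos (\<mu> n)) K)"
          by (rule inner_regular) (use B P.emeasure_finite in \<open>auto simp: less_top[symmetric]\<close>)
        finally obtain K where "K \<subseteq> B" "compact K"
          "ennreal (measure (jordan_pos (\<mu> n)) B - e) < emeasure (jordan_pos (\<mu> n)) K"
          unfolding less_SUP_iff by blast
        then show ?thesis using False by (auto simp: P.emeasure_eq_measure ennreal_less_iff)
      qed
      then obtain K where K: "K \<subseteq> B" "compact K" "measure (jordan_pos (\<mu> n)) B - e < measure (jordan_pos (\<mu> n)) K"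
        by blast
      have Kb: "K \<in> sets borel" using K(2) by (simp add: compact_imp_closed)
      have "\<mu> n (B - K) \<le> measure (jordan_pos (\<mu> n)) (B - K)"
        using B Kb by (intro le_measure_jordan_pos[OF \<mu>]) auto
      also have "\<dots> = measure (jordan_pos (\<mu> n)) B - measure (jordan_pos (\<mu> n)) K"
        using B Kb K(1) by (intro P.finite_measure_Diff) auto
      finally have "\<mu> n (B - K) \<le> e" using K(3) by simp
      moreover have "\<mu> n (B - K) = \<mu> n B - \<mu> n K" by (rule signed_measure_Diff[OF \<mu> B(1) Kb K(1)])
      moreover have "\<mu> n K \<le> C" using K B by (intro compact_le) auto
      ultimately show "\<mu> n B \<le> C + e" by linarith
    qed
  qed simp
  then show ?thesis by blast
qed

lemma vague_imp_locally_uniformly_bounded: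
  assumes \<mu>: "\<And>n. finite_signed_borel_measure (\<mu> n)" and "converges_vaguely \<mu> \<nu>"
  shows "locally_uniformly_bounded (\<lambda>n. total_variation (\<mu> n))"
proof -
  note \<mu>' = signed_measure_uminus[OF \<mu>]
  have bdd: "bounded (range (\<lambda>n. signed_integral (\<mu> n) f))"
    if "continuous_on UNIV f" "compact (closure {x. f x \<noteq> 0})" for f
    using assms(2) that convergent_imp_bounded unfolding converges_vaguely_def by blast
  have "\<exists>C. \<forall>n. measure (jordan_pos (\<mu> n)) {-r..r} \<le> C" for r
    by (rule jordan_pos_locally_bounded_if_weakly_bounded[OF \<mu> bdd])
  moreover have "\<exists>C. \<forall>n. measure (jordan_neg (\<mu> n)) {-r..r} \<le> C" for r
    unfolding jordan_neg_eq
    by (rule jordan_pos_locally_bounded_if_weakly_bounded[OF \<mu>'])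
       (use bdd in \<open>simp add: signed_integral_uminus bounded_iff\<close>)
  ultimately show ?thesis
    using finite_borel_measure_jordan_pos[OF \<mu>] finite_borel_measure_jordan_pos[OF \<mu>']
    by (simp add: locally_uniformly_bounded_total_variation_iff[OF \<mu>] locally_uniformly_bounded_iff
        jordan_neg_eq)
qed

subsection \<open>Basic convergence\<close>

text \<open>Open intervals are uncountable, so \<open>S\<close> blocks neither side of
  \<open>x\<close>. The two functions will be the Helly limit of the variations and the variation
  function of the limit measure, and a ramp is to carry little mass for both.\<close>

lemma nearby_points_avoiding_countable:
  fixes G H :: "real \<Rightarrow> real"
  assumes "countable S" "isCont G x" "isCont H x" "e > 0"
  obtains a b where "a < x" "x < b" "a \<notin> S" "b \<notin> S"
    "\<bar>G a - G x\<bar> < e" "\<bar>H a - H x\<bar> < e" "\<bar>G b - G x\<bar> < e" "\<bar>H b - H x\<bar> < e"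
proof -
  have "\<forall>\<^sub>F y in at x. dist (G y) (G x) < e" "\<forall>\<^sub>F y in at x. dist (H y) (H x) < e"
    using assms(2-4) by (auto simp: isCont_def intro: tendstoD)
  then have "\<forall>\<^sub>F y in at x. dist (G y) (G x) < e \<and> dist (H y) (H x) < e" by (rule eventually_conj)
  then obtain d where d: "d > 0"
    "\<And>y. y \<noteq> x \<Longrightarrow> dist y x < d \<Longrightarrow> dist (G y) (G x) < e \<and> dist (H y) (H x) < e"
    unfolding eventually_at by auto
  have "\<exists>y. u < y \<and> y < v \<and> y \<notin> S" if "u < v" for u v
  proof (rule ccontr)
    assume "\<not> ?thesis"
    then have "{u<..<v} \<subseteq> S" by auto
    then have "countable {u<..<v}" using assms(1) countable_subset by blast
    with that show False using uncountable_open_interval[of u v] by blast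
  qed
  from this[of "x - d" x] this[of x "x + d"] d(1) obtain a b
    where "x - d < a" "a < x" "a \<notin> S" "x < b" "b < x + d" "b \<notin> S" by auto
  with d(2)[of a] d(2)[of b] show thesis by (intro that[of a b]) (auto simp: dist_real_def)
qed

text \<open>Trapezoids replace intervals at the cost of the variation on their ramps: the Helly
  limit \<open>G\<close> controls this for \<open>\<mu> n\<close> along the subsequence, and
  \<open>H\<close> controls it for \<open>\<nu>\<close>. The two need not agree up to a constant, as
  mass of both signs may cancel in the limit.\<close>

lemma vague_imp_basic:
  assumes \<mu>: "\<And>n. finite_signed_borel_measure (\<mu> n)" and \<nu>: "finite_signed_borel_measure \<nu>"
    and vague: "converges_vaguely \<mu> \<nu>"
    and bdd: "locally_uniformly_bounded (\<lambda>n. total_variation (\<mu> n))"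
  shows "converges_basically \<mu> \<nu>"
  unfolding converges_basically_def fun_converges_basically_def
proof (intro allI impI)
  fix k :: "nat \<Rightarrow> nat" assume k: "strict_mono k"
  define P where "P n = jordan_pos (\<mu> n)" for n
  define N where "N n = jordan_neg (\<mu> n)" for n
  define P' where "P' = jordan_pos \<nu>"
  define N' where "N' = jordan_neg \<nu>"
  have fP: "finite_borel_measure (P n)" and fN: "finite_borel_measure (N n)"
    and \<mu>_eq: "A \<in> sets borel \<Longrightarrow> \<mu> n A = measure (P n) A - measure (N n) A" for n A
    using jordan_is_decomposition[OF \<mu>] by (auto simp: is_decomposition_def P_def N_def)
  have fP': "finite_borel_measure P'" and fN': "finite_borel_measure N'"
    and \<nu>_eq: "A \<in> sets borel \<Longrightarrow> \<nu> A = measure P' A - measure N' A" for A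
    using jordan_is_decomposition[OF \<nu>] by (auto simp: is_decomposition_def P'_def N'_def)
  have "(\<forall>r. \<exists>C. \<forall>n. measure (P n) {-r..r} \<le> C) \<and> (\<forall>r. \<exists>C. \<forall>n. measure (N n) {-r..r} \<le> C)"
    using bdd locally_uniformly_bounded_iff[of P] locally_uniformly_bounded_iff[of N] fP fN
    by (simp add: locally_uniformly_bounded_total_variation_iff[OF \<mu>] P_def N_def)
  then obtain CP CN where C: "\<And>r n. measure (P n) {-r..r} \<le> CP r" "\<And>r n. measure (N n) {-r..r} \<le> CN r"
    by metis
  have diff: "cdf M b - cdf M a = measure M {a<..b}" if "finite_borel_measure M" "a \<le> b" for M a b
    using finite_borel_measure.cdf_diff_eq[OF that(1), of a b] that(2) by (cases "a = b") auto
  \<comment> \<open>Subtracting the values at 0 leaves increments over bounded intervals, to which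
    the local bounds apply; mass far to the left could make the \<open>cdf\<close> values unbounded
    in \<open>n\<close>. Both parts are added so that nothing cancels.\<close>
  define f where "f n x = (cdf (P (k n)) x - cdf (P (k n)) 0) + (cdf (N (k n)) x - cdf (N (k n)) 0)" for n x
  have f_diff: "f n b - f n a = measure (P (k n)) {a<..b} + measure (N (k n)) {a<..b}" if "a \<le> b" for n a b
    using diff[OF fP that, of "k n"] diff[OF fN that, of "k n"] by (simp add: f_def)
  have rcont: "continuous (at_right x) (f n)" for n x
    unfolding f_def by (intro continuous_intros finite_borel_measure.cdf_is_right_cont fP fN)
  have mono: "mono (f n)" for n
  proof (rule monoI)
    fix a b :: real assume "a \<le> b"
    from f_diff[OF this, of n] have "f n b - f n a \<ge> 0" by simp
    then show "f n a \<le> f n b" by simp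
  qed
  have f_bdd: "\<bar>f n x\<bar> \<le> CP \<bar>x\<bar> + CN \<bar>x\<bar>" for n x
  proof -
    have *: "\<bar>cdf M x - cdf M 0\<bar> \<le> measure M {-\<bar>x\<bar>..\<bar>x\<bar>}" if M: "finite_borel_measure M" for M x
    proof -
      interpret finite_borel_measure M by fact
      have "measure M A \<le> measure M {-\<bar>x\<bar>..\<bar>x\<bar>}" if "A \<subseteq> {-\<bar>x\<bar>..\<bar>x\<bar>}" for A
        using that by (intro finite_measure_mono) auto
      then have le: "measure M {0<..x} \<le> measure M {-\<bar>x\<bar>..\<bar>x\<bar>}" "measure M {x<..0} \<le> measure M {-\<bar>x\<bar>..\<bar>x\<bar>}"
        by (auto simp: subset_iff)
      show ?thesis
      proof (cases "0 \<le> x")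
        case True
        show ?thesis using le(1) diff[OF M True] by simp
      next
        case False
        then have "cdf M 0 - cdf M x = measure M {x<..0}" by (intro diff[OF M]) simp
        then show ?thesis using le(2) measure_nonneg[of M "{x<..0}"] by linarith
      qed
    qed
    show ?thesis
      using *[OF fP[of "k n"], of x] *[OF fN[of "k n"], of x] C(1)[of "k n" "\<bar>x\<bar>"] C(2)[of "k n" "\<bar>x\<bar>"]
      unfolding f_def by linarith
  qed
  obtain s G S where s: "strict_mono (s :: nat \<Rightarrow> nat)" and S: "countable S"
    and G: "\<And>x. x \<notin> S \<Longrightarrow> isCont G x" "\<And>x. x \<notin> S \<Longrightarrow> (\<lambda>n. f (s n) x) \<longlonglongrightarrow> G x"
    using local_Helly_selection[of f, OF rcont mono f_bdd] by blast
  define H where "H x = cdf P' x + cdf N' x" for x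
  have H_diff: "H b - H a = measure P' {a<..b} + measure N' {a<..b}" if "a \<le> b" for a b
    using diff[OF fP' that] diff[OF fN' that] by (simp add: H_def)
  have "mono H"
  proof (rule monoI)
    fix a b :: real assume "a \<le> b"
    from H_diff[OF this] have "H b - H a \<ge> 0" by simp
    then show "H a \<le> H b" by simp
  qed
  define S' where "S' = S \<union> {x. \<not> isCont H x}"
  have S': "countable S'" unfolding S'_def using S mono_ctble_discont[OF \<open>mono H\<close>] by simp
  have lim: "(\<lambda>i. \<mu> (k (s i)) {c<..d}) \<longlonglongrightarrow> \<nu> {c<..d}" if cd: "c \<notin> S'" "d \<notin> S'" "c < d" for c d
  proof (rule LIMSEQ_by_approximation)
    fix e :: real assume e: "e > 0"
    have cont: "isCont G c" "isCont G d" "isCont H c" "isCont H d"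
      using cd G(1) by (auto simp: S'_def)
    \<comment> \<open>The outer ends avoid \<open>S'\<close> as well, so the increments of
      \<open>f\<close> over the ramps, which are the combined masses of both parts there, converge
      to increments of \<open>G\<close>.\<close>
    obtain a where a: "a < c" "a \<notin> S'" "\<bar>G a - G c\<bar> < e/2" "\<bar>H a - H c\<bar> < e/2"
      using nearby_points_avoiding_countable[OF S' cont(1,3), of "e/2"] e by auto
    obtain b where b: "d < b" "b \<notin> S'" "\<bar>G b - G d\<bar> < e/2" "\<bar>H b - H d\<bar> < e/2"
      using nearby_points_avoiding_countable[OF S' cont(2,4), of "e/2"] e by auto
    obtain \<phi> :: "real \<Rightarrow> real" where \<phi>: "continuous_on UNIV \<phi>" "compact (closure {x. \<phi> x \<noteq> 0})"
      and err: "\<And>M. finite_borel_measure M \<Longrightarrow>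
        \<bar>integral\<^sup>L M \<phi> - measure M {c<..d}\<bar> \<le> measure M {a<..c} + measure M {d<..b}"
      using trapezoid_function[of a c d b] a(1) b(1) cd(3) by auto
    have "(\<lambda>n. signed_integral (\<mu> n) \<phi>) \<longlonglongrightarrow> signed_integral \<nu> \<phi>"
      using vague \<phi> by (simp add: converges_vaguely_def)
    from LIMSEQ_subseq_LIMSEQ[OF this strict_mono_compose[OF k s]]
    have 1: "(\<lambda>i. signed_integral (\<mu> (k (s i))) \<phi>) \<longlonglongrightarrow> signed_integral \<nu> \<phi>"
      by (simp add: o_def)
    have "(\<lambda>i. (f (s i) c - f (s i) a) + (f (s i) b - f (s i) d)) \<longlonglongrightarrow> (G c - G a) + (G b - G d)"
      using a(2) b(2) cd by (intro tendsto_intros G(2)) (auto simp: S'_def)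
    moreover have "(G c - G a) + (G b - G d) < e" using a(3) b(3) by linarith
    ultimately have "\<forall>\<^sub>F i in sequentially. (f (s i) c - f (s i) a) + (f (s i) b - f (s i) d) < e"
      by (rule order_tendstoD(2))
    then have 2: "\<forall>\<^sub>F i in sequentially. \<bar>\<mu> (k (s i)) {c<..d} - signed_integral (\<mu> (k (s i))) \<phi>\<bar> \<le> e"
    proof eventually_elim
      case (elim i)
      have "\<mu> (k (s i)) {c<..d} = measure (P (k (s i))) {c<..d} - measure (N (k (s i))) {c<..d}"
        by (simp add: \<mu>_eq)
      moreover have "signed_integral (\<mu> (k (s i))) \<phi> = integral\<^sup>L (P (k (s i))) \<phi> - integral\<^sup>L (N (k (s i))) \<phi>"
        by (simp add: signed_integral_def P_def N_def)
      ultimately show ?case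
        using elim err[OF fP[of "k (s i)"]] err[OF fN[of "k (s i)"]]
          f_diff[of a c "s i"] f_diff[of d b "s i"] a(1) b(1) by linarith
    qed
    have "\<nu> {c<..d} = measure P' {c<..d} - measure N' {c<..d}" by (simp add: \<nu>_eq)
    moreover have "signed_integral \<nu> \<phi> = integral\<^sup>L P' \<phi> - integral\<^sup>L N' \<phi>"
      by (simp add: signed_integral_def P'_def N'_def)
    ultimately have "\<bar>\<nu> {c<..d} - signed_integral \<nu> \<phi>\<bar> \<le> e"
      using err[OF fP'] err[OF fN'] H_diff[of a c] H_diff[of d b] a(1,4) b(1,4) by linarith
    with 1 2 show "\<exists>S L'. S \<longlonglongrightarrow> L' \<and>
        (\<forall>\<^sub>F i in sequentially. \<bar>\<mu> (k (s i)) {c<..d} - S i\<bar> \<le> e) \<and> \<bar>\<nu> {c<..d} - L'\<bar> \<le> e"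
      by blast
  qed
  have "(\<lambda>i. distribution_function (\<mu> (k (s i))) x1 - distribution_function (\<mu> (k (s i))) x2)
      \<longlonglongrightarrow> distribution_function \<nu> x1 - distribution_function \<nu> x2"
    if x: "x1 \<in> - S'" "x2 \<in> - S'" for x1 x2
  proof (cases x1 x2 rule: linorder_cases)
    case less
    then have "(\<lambda>i. - \<mu> (k (s i)) {x1<..x2}) \<longlonglongrightarrow> - \<nu> {x1<..x2}"
      using x by (intro tendsto_minus lim) auto
    then show ?thesis
      using less by (simp flip: distribution_function_diff[OF \<mu>] distribution_function_diff[OF \<nu>])
  next
    case greater
    then show ?thesis
      using x lim[of x2 x1]
      by (simp add: distribution_function_diff[OF \<mu>] distribution_function_diff[OF \<nu>])
  qed simp
  then show "\<exists>l S. strict_mono l \<and> countable S \<and> (\<forall>x1\<in>- S. \<forall>x2\<in>- S.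
      (\<lambda>i. distribution_function (\<mu> (k (l i))) x1 - distribution_function (\<mu> (k (l i))) x2)
        \<longlonglongrightarrow> distribution_function \<nu> x1 - distribution_function \<nu> x2)"
    using s S' by (intro exI[of _ s] exI[of _ S'] conjI ballI) simp_all
qed

lemma basic_imp_almost_basic: "converges_basically \<mu> \<nu> \<Longrightarrow> converges_almost_basically \<mu> \<nu>"
proof -
  have "countable S \<Longrightarrow> S \<in> null_sets lebesgue" for S :: "real set"
    by (intro null_sets_completionI countable_imp_null_set_lborel)
  then show "converges_basically \<mu> \<nu> \<Longrightarrow> converges_almost_basically \<mu> \<nu>"
    unfolding converges_basically_def converges_almost_basically_def
      fun_converges_basically_def fun_converges_almost_basically_def by meson
qed

text \<open>On an interval with ends in \<open>D\<close>, the mass under \<open>P n\<close> is the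
  bounded difference plus the mass under \<open>N n\<close>. Such an interval is fitted between
  \<open>{-r..r}\<close> and a slightly larger symmetric one, where the bound for \<open>N\<close>
  applies.\<close>

lemma locally_bounded_if_bounded_difference:
  fixes P N :: "nat \<Rightarrow> real measure"
  assumes P: "\<And>n. finite_borel_measure (P n)" and N: "\<And>n. finite_borel_measure (N n)"
    and D: "\<And>a b. a < b \<Longrightarrow> \<exists>x\<in>D. a < x \<and> x < b"
    and diff: "\<And>a b. a \<in> D \<Longrightarrow> b \<in> D \<Longrightarrow> a < b \<Longrightarrow> Bseq (\<lambda>n. measure (P n) {a<..b} - measure (N n) {a<..b})"
    and bdd: "\<And>r. \<exists>C. \<forall>n. measure (N n) {-r..r} \<le> C"
  shows "\<exists>C. \<forall>n. measure (P n) {-r..r} \<le> C"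
proof -
  obtain a b where a: "a \<in> D" "- \<bar>r\<bar> - 2 < a" "a < - \<bar>r\<bar> - 1" and b: "b \<in> D" "\<bar>r\<bar> + 1 < b" "b < \<bar>r\<bar> + 2"
    using D[of "- \<bar>r\<bar> - 2" "- \<bar>r\<bar> - 1"] D[of "\<bar>r\<bar> + 1" "\<bar>r\<bar> + 2"] by auto
  have "a < b" using a b by linarith
  from diff[OF a(1) b(1) this] obtain K
    where K: "\<And>n. \<bar>measure (P n) {a<..b} - measure (N n) {a<..b}\<bar> \<le> K"
    unfolding Bseq_def real_norm_def by blast
  obtain C where C: "\<And>n. measure (N n) {-(\<bar>r\<bar> + 2)..\<bar>r\<bar> + 2} \<le> C" using bdd[of "\<bar>r\<bar> + 2"] by blast
  have "measure (P n) {-r..r} \<le> K + C" for n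
  proof -
    interpret P: finite_borel_measure "P n" by (rule P)
    interpret N: finite_borel_measure "N n" by (rule N)
    have "measure (P n) {-r..r} \<le> measure (P n) {a<..b}"
      using a b by (intro P.finite_measure_mono) auto
    moreover have "measure (N n) {a<..b} \<le> measure (N n) {-(\<bar>r\<bar> + 2)..\<bar>r\<bar> + 2}"
      using a b by (intro N.finite_measure_mono) auto
    ultimately show ?thesis using K[of n] C[of n] by linarith
  qed
  then show ?thesis by blast
qed

text \<open>One part is bounded along the whole sequence. The other inherits a bound only along the
  selected subsequence, where increments converge and are therefore bounded; this suffices because
  the limit is tested on further subsequences.\<close>

lemma almost_basic_imp_vague:
  assumes \<mu>: "\<And>n. finite_signed_borel_measure (\<mu> n)" and \<nu>: "finite_signed_borel_measure \<nu>"
    and dec: "\<And>n. is_decomposition (\<mu> n) (P n) (N n)"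
    and conv: "converges_almost_basically \<mu> \<nu>"
    and bdd: "locally_uniformly_bounded (\<lambda>n. emeasure (P n)) \<or> locally_uniformly_bounded (\<lambda>n. emeasure (N n))"
  shows "converges_vaguely \<mu> \<nu>"
  unfolding converges_vaguely_def
proof (intro allI impI)
  fix f :: "real \<Rightarrow> real" assume f: "continuous_on UNIV f" "compact (closure {x. f x \<noteq> 0})"
  have fP: "finite_borel_measure (P n)" and fN: "finite_borel_measure (N n)"
    and \<mu>_eq: "A \<in> sets borel \<Longrightarrow> measure (P n) A - measure (N n) A = \<mu> n A" for n A
    using dec by (auto simp: is_decomposition_def)
  define P' where "P' = jordan_pos \<nu>"
  define N' where "N' = jordan_neg \<nu>"
  have fP': "finite_borel_measure P'" and fN': "finite_borel_measure N'"
    and \<nu>_eq: "A \<in> sets borel \<Longrightarrow> measure P' A - measure N' A = \<nu> A" for A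
    using jordan_is_decomposition[OF \<nu>] by (auto simp: is_decomposition_def P'_def N'_def)
  have bdd': "(\<forall>r. \<exists>C. \<forall>n. measure (P n) {-r..r} \<le> C) \<or> (\<forall>r. \<exists>C. \<forall>n. measure (N n) {-r..r} \<le> C)"
    using bdd locally_uniformly_bounded_iff[of P, OF fP] locally_uniformly_bounded_iff[of N, OF fN] by blast
  show "(\<lambda>n. signed_integral (\<mu> n) f) \<longlonglongrightarrow> signed_integral \<nu> f"
  proof (rule LIMSEQ_if_subsubsequence)
    fix k :: "nat \<Rightarrow> nat" assume "strict_mono k"
    then obtain l :: "nat \<Rightarrow> nat" and S where l: "strict_mono l" and S: "S \<in> null_sets lebesgue"
      and lim: "\<And>x1 x2. x1 \<notin> S \<Longrightarrow> x2 \<notin> S \<Longrightarrow>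
        (\<lambda>i. distribution_function (\<mu> (k (l i))) x1 - distribution_function (\<mu> (k (l i))) x2)
          \<longlonglongrightarrow> distribution_function \<nu> x1 - distribution_function \<nu> x2"
      using conv unfolding converges_almost_basically_def fun_converges_almost_basically_def by fastforce
    \<comment> \<open>The complement of a null set is dense, as nonempty open intervals have
      positive Lebesgue measure.\<close>
    have D: "\<exists>x\<in>- S. a < x \<and> x < b" if "a < b" for a b
    proof (rule ccontr)
      assume "\<not> ?thesis"
      then have "{a<..<b} \<subseteq> S" by auto
      then have "{a<..<b} \<in> null_sets lebesgue" by (intro null_sets_subset[OF S]) auto
      then have "{a<..<b} \<in> null_sets lborel" by (simp add: null_sets_completion_iff)
      then show False using that by (simp add: null_sets_def)
    qed
    have lim': "(\<lambda>i. measure (P (k (l i))) {a<..b} - measure (N (k (l i))) {a<..b})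
        \<longlonglongrightarrow> measure P' {a<..b} - measure N' {a<..b}" if "a \<in> - S" "b \<in> - S" "a < b" for a b
      using lim[of b a] that
      by (simp add: distribution_function_diff[OF \<mu>] distribution_function_diff[OF \<nu>] \<mu>_eq \<nu>_eq)
    have B: "Bseq (\<lambda>i. measure (P (k (l i))) {a<..b} - measure (N (k (l i))) {a<..b})"
      "Bseq (\<lambda>i. measure (N (k (l i))) {a<..b} - measure (P (k (l i))) {a<..b})"
      if "a \<in> - S" "b \<in> - S" "a < b" for a b
      using lim'[OF that] tendsto_minus[OF lim'[OF that]]
      by (auto intro!: convergent_imp_Bseq convergentI)
    have "(\<exists>C. \<forall>i. measure (P (k (l i))) {-r..r} \<le> C) \<and> (\<exists>C. \<forall>i. measure (N (k (l i))) {-r..r} \<le> C)" for r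
      using bdd'
    proof
      assume P: "\<forall>r. \<exists>C. \<forall>n. measure (P n) {-r..r} \<le> C"
      have "\<exists>C. \<forall>i. measure (N (k (l i))) {-r..r} \<le> C"
        by (rule locally_bounded_if_bounded_difference[OF fN fP D B(2)]) (use P in blast)+
      with P show ?thesis by blast
    next
      assume N: "\<forall>r. \<exists>C. \<forall>n. measure (N n) {-r..r} \<le> C"
      have "\<exists>C. \<forall>i. measure (P (k (l i))) {-r..r} \<le> C"
        by (rule locally_bounded_if_bounded_difference[OF fP fN D B(1)]) (use N in blast)+
      with N show ?thesis by blast
    qed
    then have "\<exists>C. \<forall>i. measure (P (k (l i))) {-r..r} \<le> C \<and> measure (N (k (l i))) {-r..r} \<le> C" for r
      by (meson max.coboundedI1 max.coboundedI2)
    then have "(\<lambda>i. integral\<^sup>L (P (k (l i))) f - integral\<^sup>L (N (k (l i))) f) \<longlonglongrightarrow> integral\<^sup>L P' f - integral\<^sup>L N' f"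
      by (intro vague_limit_from_dense_intervals[OF fP fN fP' fN' D lim' _ f])
    \<comment> \<open>\<open>P\<close> and \<open>N\<close> need not be the Jordan parts, so for
      \<open>\<mu> n\<close> independence of the decomposition enters; for \<open>\<nu>\<close> the
      Jordan parts are the definition.\<close>
    then have "(\<lambda>i. signed_integral (\<mu> (k (l i))) f) \<longlonglongrightarrow> signed_integral \<nu> f"
      by (simp add: signed_integral_decomposition[OF \<mu> dec f] signed_integral_def[of \<nu>] P'_def N'_def)
    with l show "\<exists>l. strict_mono l \<and> (\<lambda>i. signed_integral (\<mu> (k (l i))) f) \<longlonglongrightarrow> signed_integral \<nu> f" by blast
  qed
qed

theorem theorem3p12:
  fixes \<mu> :: "nat \<Rightarrow> real set \<Rightarrow> real" and \<nu> :: "real set \<Rightarrow> real"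
  assumes "\<And>n. finite_signed_borel_measure (\<mu> n)"
    and "finite_signed_borel_measure \<nu>"
  shows "(converges_vaguely \<mu> \<nu> \<longleftrightarrow>
            converges_basically \<mu> \<nu> \<and> locally_uniformly_bounded (\<lambda>n. total_variation (\<mu> n)))
       \<and> (converges_vaguely \<mu> \<nu> \<longleftrightarrow>
            converges_almost_basically \<mu> \<nu> \<and> locally_uniformly_bounded (\<lambda>n. total_variation (\<mu> n)))
       \<and> (\<forall>P N :: nat \<Rightarrow> real measure.
            (\<forall>n. is_decomposition (\<mu> n) (P n) (N n)) \<longrightarrow>
            converges_basically \<mu> \<nu> \<or> converges_almost_basically \<mu> \<nu> \<longrightarrow>
            locally_uniformly_bounded (\<lambda>n. emeasure (P n)) \<or>
              locally_uniformly_bounded (\<lambda>n. emeasure (N n)) \<longrightarrow>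
            converges_vaguely \<mu> \<nu>)"
proof -
  let ?TV = "locally_uniformly_bounded (\<lambda>n. total_variation (\<mu> n))"
  \<comment> \<open>The implications form a cycle: vague convergence gives basic convergence with
    local boundedness, hence almost basic convergence with local boundedness, hence vague
    convergence. Both equivalences follow at once.\<close>
  have vague: "?TV \<and> converges_basically \<mu> \<nu>" if "converges_vaguely \<mu> \<nu>"
    using vague_imp_locally_uniformly_bounded[OF assms(1) that] vague_imp_basic[OF assms that] by blast
  have "converges_vaguely \<mu> \<nu>" if "converges_almost_basically \<mu> \<nu>" ?TV
    using almost_basic_imp_vague[OF assms jordan_is_decomposition[OF assms(1)] that(1)] that(2)
    by (simp add: locally_uniformly_bounded_total_variation_iff[OF assms(1)])
  then show ?thesis
    using vague basic_imp_almost_basic[of \<mu> \<nu>] almost_basic_imp_vague[of \<mu> \<nu>, OF assms] by metis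
qed

end
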